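(* The problem \textsc{Unlabelled Undirected Token Moving} (UUTM) is fixed-parameter tractable when parameterized by $\ell$: there is an algorithm deciding every instance $(G,S,T,\ell)$ in time $g(\ell)\cdot n^{O(1)}$ for some computable function $g$, where $n$ is the size of the instance.
   Context: Tokens sit on vertices of an undirected graph $G$. An (unlabelled) configuration is a set $C\subseteq V(G)$, meaning one token on each vertex of $C$. A move is a pair $(s,t)$ of vertices; executing it moves the token on $s$ to $t$. A vertex is free if it carries no token; a path is free if all its intermediate vertices are free. A move $(s,t)$ in a sequence is valid if, after executing the preceding moves of the sequence, there is a token on $s$, $t$ is free, and there is a free path from $s$ to $t$. A transforming sequence from $S$ to $T$ is a sequence of valid moves whose execution starting from configuration $S$ yields configuration $T$. UUTM: given an undirected graph $G$, configurations $S,T\subseteq V(G)$ with $|S|=|T|=k$, and an integer $\ell$, decide whether there is a transforming sequence from $S$ to $T$ of length at most $\ell$ (and output one). *)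

theory Defs
  imports "Graph_Theory.Pair_Digraph" "Graph_Theory.Vertex_Walk"
begin

section \<open>Model of computation\<close>

text \<open>
  Algorithms are programs of a first-order, call-by-value functional language whose only data
  are binary trees (the tree languages of N. D. Jones, Computability and Complexity from a
  Programming Perspective, 1997). The cost of a run is the number of evaluation steps,
  each of which builds, destructs or inspects at most one tree node or performs one call of fixed
  arity. With subtrees represented by pointers, a step takes constantly many operations on
  a random access machine, and conversely the language simulates Turing machines with linear
  overhead. Hence running times agree up to polynomials with those of Turing machines, and both
  the class of computable functions and the notion of fixed-parameter tractability are the
  usual ones.
\<close>

datatype dtree = Leaf | Node dtree dtree

primrec tree_size :: "dtree \<Rightarrow> nat" where
  "tree_size Leaf = 1"
| "tree_size (Node x y) = tree_size x + tree_size y + 1"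

primrec left :: "dtree \<Rightarrow> dtree" where
  "left Leaf = Leaf"
| "left (Node x y) = x"

primrec right :: "dtree \<Rightarrow> dtree" where
  "right Leaf = Leaf"
| "right (Node x y) = y"

text \<open>
  A program is the list of the bodies of its mutually recursive functions; function 0 is
  the main function. \<open>Var i\<close> is the \<open>i\<close>-th argument of the current call, and \<open>If\<close> takes the
  second branch exactly if the condition evaluates to \<open>Leaf\<close>.
\<close>

datatype exp =
    Var nat
  | LeafE
  | NodeE exp exp
  | LeftE exp
  | RightE exp
  | If exp exp exp
  | Call nat "exp list"

type_synonym prog = "exp list"

text \<open>
  \<open>eval P vs e v n\<close>: in program \<open>P\<close> with arguments \<open>vs\<close>, the expression \<open>e\<close> evaluates
  to \<open>v\<close> in exactly \<open>n\<close> steps. Diverging computations and those that refer to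
  undefined arguments or functions have no derivation.
\<close>

inductive eval :: "prog \<Rightarrow> dtree list \<Rightarrow> exp \<Rightarrow> dtree \<Rightarrow> nat \<Rightarrow> bool"
  and evals :: "prog \<Rightarrow> dtree list \<Rightarrow> exp list \<Rightarrow> dtree list \<Rightarrow> nat \<Rightarrow> bool"
  for P :: prog
where
  Var: "i < length vs \<Longrightarrow> eval P vs (Var i) (vs ! i) 1"
| LeafE: "eval P vs LeafE Leaf 1"
| NodeE: "eval P vs a x m \<Longrightarrow> eval P vs b y n \<Longrightarrow> eval P vs (NodeE a b) (Node x y) (m + n + 1)"
| LeftE: "eval P vs a x m \<Longrightarrow> eval P vs (LeftE a) (left x) (m + 1)"
| RightE: "eval P vs a x m \<Longrightarrow> eval P vs (RightE a) (right x) (m + 1)"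
| If_true: "eval P vs c x m \<Longrightarrow> x \<noteq> Leaf \<Longrightarrow> eval P vs a v n \<Longrightarrow> eval P vs (If c a b) v (m + n + 1)"
| If_false: "eval P vs c Leaf m \<Longrightarrow> eval P vs b v n \<Longrightarrow> eval P vs (If c a b) v (m + n + 1)"
| Call: "evals P vs es ws m \<Longrightarrow> f < length P \<Longrightarrow> eval P ws (P ! f) v n \<Longrightarrow>
    eval P vs (Call f es) v (m + n + 1)"
| Nil: "evals P vs [] [] 0"
| Cons: "eval P vs e v m \<Longrightarrow> evals P vs es ws n \<Longrightarrow> evals P vs (e # es) (v # ws) (m + n)"

definition runs :: "prog \<Rightarrow> dtree \<Rightarrow> dtree \<Rightarrow> nat \<Rightarrow> bool" where
  "runs P x v n \<longleftrightarrow> eval P [x] (Call 0 [Var 0]) v n"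

inductive_cases eval_VarE: "eval P vs (Var i) v n"
inductive_cases eval_LeafEE: "eval P vs LeafE v n"
inductive_cases eval_NodeEE: "eval P vs (NodeE a b) v n"
inductive_cases eval_LeftEE: "eval P vs (LeftE a) v n"
inductive_cases eval_RightEE: "eval P vs (RightE a) v n"
inductive_cases eval_IfE: "eval P vs (If c a b) v n"
inductive_cases eval_CallE: "eval P vs (Call f es) v n"
inductive_cases evals_NilE: "evals P vs [] ws n"
inductive_cases evals_ConsE: "evals P vs (e # es) ws n"

lemma eval_evals_deterministic:
  shows "eval P vs e v n \<Longrightarrow> (\<forall>v' n'. eval P vs e v' n' \<longrightarrow> v' = v \<and> n' = n)"
    and "evals P vs es ws n \<Longrightarrow> (\<forall>ws' n'. evals P vs es ws' n' \<longrightarrow> ws' = ws \<and> n' = n)"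
proof (induction rule: eval_evals.inducts)
  case (Var i vs) then show ?case by (auto elim: eval_VarE)
next
  case (LeafE vs) then show ?case by (auto elim: eval_LeafEE)
next
  case (NodeE vs a x m b y n) then show ?case by (intro allI impI) (erule eval_NodeEE; metis Suc_eq_plus1)
next
  case (LeftE vs a x m) then show ?case by (intro allI impI) (erule eval_LeftEE; metis Suc_eq_plus1)
next
  case (RightE vs a x m) then show ?case by (intro allI impI) (erule eval_RightEE; metis Suc_eq_plus1)
next
  case (If_true vs c x m a v n b) then show ?case by (intro allI impI) (erule eval_IfE; metis Suc_eq_plus1)
next
  case (If_false vs c m b v n a) then show ?case by (intro allI impI) (erule eval_IfE; metis Suc_eq_plus1)
next
  case (Call vs es ws m f v n) then show ?case by (intro allI impI) (erule eval_CallE; metis Suc_eq_plus1)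
next
  case (Nil vs) then show ?case by (auto elim: evals_NilE)
next
  case (Cons vs e v m es ws n) then show ?case by (intro allI impI) (erule evals_ConsE; metis Suc_eq_plus1)
qed

text \<open>Natural numbers are encoded in binary, least significant bit first.\<close>

fun enc_nat :: "nat \<Rightarrow> dtree" where
  "enc_nat n = (if n = 0 then Leaf
     else Node (if odd n then Node Leaf Leaf else Leaf) (enc_nat (n div 2)))"

declare enc_nat.simps [simp del]

fun enc_list :: "('a \<Rightarrow> dtree) \<Rightarrow> 'a list \<Rightarrow> dtree" where
  "enc_list f [] = Leaf"
| "enc_list f (x # xs) = Node (f x) (enc_list f xs)"

definition enc_pair :: "nat \<times> nat \<Rightarrow> dtree" where
  "enc_pair p = Node (enc_nat (fst p)) (enc_nat (snd p))"

lemma enc_nat_inject: "enc_nat m = enc_nat n \<longleftrightarrow> m = n"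
proof
  show "enc_nat m = enc_nat n \<Longrightarrow> m = n"
  proof (induction m arbitrary: n rule: less_induct)
    case (less m)
    show ?case
    proof (cases "m = 0 \<or> n = 0")
      case True
      then show ?thesis using less.prems
        by (auto simp: enc_nat.simps[of m] enc_nat.simps[of n] split: if_splits)
    next
      case False
      then have eq: "enc_nat (m div 2) = enc_nat (n div 2)" "odd m \<longleftrightarrow> odd n"
        using less.prems by (auto simp: enc_nat.simps[of m] enc_nat.simps[of n] split: if_splits)
      have "m div 2 = n div 2" using False less.IH[OF _ eq(1)] by simp
      then show ?thesis using eq(2) by (metis bit_eq_rec)
    qed
  qed
qed simp

lemma enc_list_inject: "inj f \<Longrightarrow> enc_list f xs = enc_list f ys \<longleftrightarrow> xs = ys"
proof (induction xs arbitrary: ys)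
  case Nil then show ?case by (cases ys) auto
next
  case (Cons x xs) then show ?case by (cases ys) (auto dest: injD)
qed

definition computable :: "(nat \<Rightarrow> nat) \<Rightarrow> bool" where
  "computable g \<longleftrightarrow> (\<exists>P. \<forall>k. \<exists>n. runs P (enc_nat k) (enc_nat (g k)) n)"

text \<open>
  A parameterized problem is given by its instances \<open>inst\<close>, the relation \<open>enc i x\<close> of an
  instance to the trees representing it (as the vertices and edges of a graph may
  be listed in any order, there can be several, and an algorithm has to cope with all of them),
  the parameter \<open>par\<close> and the yes-instances \<open>yes\<close>. A program answers yes by
  returning a tree other than \<open>Leaf\<close>.
\<close>

definition fixed_parameter_tractable ::
  "('i \<Rightarrow> bool) \<Rightarrow> ('i \<Rightarrow> dtree \<Rightarrow> bool) \<Rightarrow> ('i \<Rightarrow> nat) \<Rightarrow> ('i \<Rightarrow> bool) \<Rightarrow> bool" where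
  "fixed_parameter_tractable inst enc par yes \<longleftrightarrow>
     (\<exists>P g c. computable g \<and>
       (\<forall>i x. inst i \<and> enc i x \<longrightarrow>
         (\<exists>v n. runs P x v n \<and> n \<le> g (par i) * tree_size x ^ c \<and> (v \<noteq> Leaf \<longleftrightarrow> yes i))))"


section \<open>Unlabelled token moving\<close>

text \<open>
  A \<open>pair_graph\<close> is a finite simple undirected graph, given by its vertices and its symmetric,
  irreflexive set of arcs.
\<close>

definition free_path :: "'a pair_pre_digraph \<Rightarrow> 'a set \<Rightarrow> 'a list \<Rightarrow> bool" where
  "free_path G C p \<longleftrightarrow> vpath p (with_proj G) \<and> set (butlast (tl p)) \<inter> C = {}"

type_synonym 'a move = "'a \<times> 'a"

definition valid_move :: "'a pair_pre_digraph \<Rightarrow> 'a set \<Rightarrow> 'a move \<Rightarrow> bool" where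
  "valid_move G C m \<longleftrightarrow>
     fst m \<in> C \<and> snd m \<in> pverts G \<and> snd m \<notin> C \<and>
     (\<exists>p. free_path G C p \<and> hd p = fst m \<and> last p = snd m)"

definition execute :: "'a move \<Rightarrow> 'a set \<Rightarrow> 'a set" where
  "execute m C = insert (snd m) (C - {fst m})"

fun transforming_sequence ::
  "'a pair_pre_digraph \<Rightarrow> 'a set \<Rightarrow> 'a move list \<Rightarrow> 'a set \<Rightarrow> bool" where
  "transforming_sequence G S [] T \<longleftrightarrow> S = T"
| "transforming_sequence G S (m # ms) T \<longleftrightarrow>
     valid_move G S m \<and> transforming_sequence G (execute m S) ms T"

type_synonym uutm = "nat pair_pre_digraph \<times> nat set \<times> nat set \<times> nat"

definition uutm_instance :: "uutm \<Rightarrow> bool" where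
  "uutm_instance = (\<lambda>(G, S, T, l).
     pair_graph G \<and> S \<subseteq> pverts G \<and> T \<subseteq> pverts G \<and> card S = card T)"

definition uutm_yes :: "uutm \<Rightarrow> bool" where
  "uutm_yes = (\<lambda>(G, S, T, l). \<exists>ms. transforming_sequence G S ms T \<and> length ms \<le> l)"

definition uutm_parameter :: "uutm \<Rightarrow> nat" where
  "uutm_parameter = (\<lambda>(G, S, T, l). l)"

text \<open>
  As \<open>parcs G\<close> is symmetric, the list \<open>es\<close> contains every edge in both orientations.
\<close>

definition uutm_encoding :: "uutm \<Rightarrow> dtree \<Rightarrow> bool" where
  "uutm_encoding = (\<lambda>(G, S, T, l) x. \<exists>vs es ss ts.
     distinct vs \<and> set vs = pverts G \<and>
     distinct es \<and> set es = parcs G \<and>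
     distinct ss \<and> set ss = S \<and>
     distinct ts \<and> set ts = T \<and>
     x = Node (enc_list enc_nat vs) (Node (enc_list enc_pair es)
           (Node (enc_list enc_nat ss) (Node (enc_list enc_nat ts) (enc_nat l)))))"

lemma uutm_encoding_unique:
  assumes "uutm_encoding i x" and "uutm_encoding j x"
  shows "i = j"
proof -
  have "inj enc_nat" by (simp add: inj_def enc_nat_inject)
  moreover have "inj enc_pair" by (auto simp: inj_def enc_pair_def enc_nat_inject)
  ultimately show ?thesis using assms
    by (cases i; cases j)
      (auto simp: uutm_encoding_def enc_nat_inject enc_list_inject
        intro!: pair_pre_digraph.equality)
qed

lemma uutm_encoding_exists:
  assumes "uutm_instance i"
  shows "\<exists>x. uutm_encoding i x"
proof -
  obtain G S T l where i: "i = (G, S, T, l)" by (cases i)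
  have G: "pair_graph G" and sub: "S \<subseteq> pverts G" "T \<subseteq> pverts G"
    using assms by (auto simp: i uutm_instance_def)
  interpret pair_graph G by (fact G)
  have fin: "finite (pverts G)" "finite (parcs G)" "finite S" "finite T"
    using pair_finite_verts pair_finite_arcs sub finite_subset by blast+
  obtain vs es ss ts where "set vs = pverts G" "distinct vs" "set es = parcs G" "distinct es"
    "set ss = S" "distinct ss" "set ts = T" "distinct ts"
    using fin[THEN finite_distinct_list] by blast
  then show ?thesis unfolding i uutm_encoding_def prod.case by blast
qed

end

theory Submission
  imports Defs "HOL-Library.Multiset"
begin

text \<open>
  Vertices of \<open>S \<inter> T\<close> are obstacles. A token on an obstacle either never moves or costs one move, and
  every vertex of \<open>S - T\<close> costs one move. If \<open>O'\<close> is the set of obstacles whose token moves, all moves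
  stay within a connected component of the graph without the other obstacles, so every component
  contains equally many vertices of \<open>S\<close> and \<open>T\<close>. Conversely, in a connected graph the tokens can be
  moved from \<open>S\<close> to \<open>T\<close> with one move per token. Hence the question is whether at most \<open>l - card (S - T)\<close>
  obstacles can be removed such that every component becomes balanced.

  This is a Steiner forest problem with at most \<open>2 * l\<close> terminals, solved in the manner of Dreyfus and Wagner:
  for a list of terminals and units of budget, one computes the vertices that can be
  connected to them within the budget, by trying all ways to split the list in two. A part
  that contains equally many vertices of \<open>S - T\<close> and \<open>T - S\<close> may also be completed on its own.
\<close>

section \<open>Balanced cuts\<close>

text \<open>Components are never named. For symmetric \<open>E\<close>,
  \<open>closed_in E H K\<close> says that \<open>K \<inter> H\<close> is a union of components of
  the graph induced on \<open>H\<close>, and balance is demanded of all such \<open>K\<close>. No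
  move changes the count on such a set if the resting tokens are cut out, and the condition passes
  through every rule of a derivation. The forest may have several trees, each balanced by itself, so
  a derivation cannot be one growing tree: the excess of a part decides whether it may be left
  behind. Units of budget are items just like terminals, so that one distribution of a list splits
  both. Sublists are solved again instead of being tabulated. This makes the exponent quadratic in
  \<open>l\<close>, which is still a function of the parameter alone. As \<open>l\<close> is written
  in binary, it may exceed the input size; lengths are therefore measured against the input size
  times \<open>2 * l + 2\<close>. The function \<open>g\<close> is a double exponential because such
  a number is easy to write down in binary.\<close>

definition closed_in :: "'a rel \<Rightarrow> 'a set \<Rightarrow> 'a set \<Rightarrow> bool" where
  "closed_in E H K \<longleftrightarrow> (\<forall>x y. (x, y) \<in> E \<longrightarrow> x \<in> H \<longrightarrow> y \<in> H \<longrightarrow> x \<in> K \<longrightarrow> y \<in> K)"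

lemma closed_in_mono: "closed_in E H K \<Longrightarrow> H' \<subseteq> H \<Longrightarrow> closed_in E H' K"
  unfolding closed_in_def by blast

lemma closed_in_Compl: "sym E \<Longrightarrow> closed_in E H K \<Longrightarrow> closed_in E H (- K)"
  unfolding closed_in_def by (metis ComplD ComplI symD)

text \<open>Connected sets together with a building order. The vertex added last can be taken away
  again without disconnecting the rest, which is what the induction on moves needs.\<close>

inductive grown :: "'a rel \<Rightarrow> 'a \<Rightarrow> 'a set \<Rightarrow> bool" for E r where
  root: "grown E r {r}"
| leaf: "grown E r X \<Longrightarrow> u \<in> X \<Longrightarrow> (u, v) \<in> E \<Longrightarrow> v \<notin> X \<Longrightarrow> grown E r (insert v X)"

lemma grown_root: "grown E r X \<Longrightarrow> r \<in> X"
  by (induction rule: grown.induct) auto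

text \<open>The new vertex lies on the same side of \<open>K\<close> as its neighbour
  \<open>u\<close>, so a closed set never cuts a grown one.\<close>

lemma grown_closed:
  assumes "grown E r X" and "sym E" and "closed_in E X K"
  shows "K \<inter> X = {} \<or> X \<subseteq> K"
  using assms
proof (induction rule: grown.induct)
  case root then show ?case by auto
next
  case (leaf X u v)
  then have "K \<inter> X = {} \<or> X \<subseteq> K" by (meson closed_in_mono subset_insertI)
  moreover have "u \<in> K \<longleftrightarrow> v \<in> K"
    using leaf.prems leaf.hyps unfolding closed_in_def by (metis insertCI symD)
  ultimately show ?case using leaf.hyps(2) by blast
qed

text \<open>A maximal grown subset of \<open>H\<close> is closed, since an arc leaving it inside
  \<open>H\<close> would extend it.\<close>

lemma exists_grown_component:
  assumes fin: "finite H" and r: "r \<in> H"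
  shows "\<exists>X. grown E r X \<and> X \<subseteq> H \<and> closed_in E H X"
proof -
  let ?P = "\<lambda>X. grown E r X \<and> X \<subseteq> H"
  have "finite {X. ?P X}" using fin by (rule_tac finite_subset[of _ "Pow H"]) auto
  moreover have "{X. ?P X} \<noteq> {}" using r grown.root by fastforce
  ultimately obtain X where X: "?P X" and max: "\<And>Y. ?P Y \<Longrightarrow> X \<subseteq> Y \<Longrightarrow> X = Y"
    using finite_has_maximal[of "{X. ?P X}"] by (metis mem_Collect_eq)
  have "closed_in E H X"
    unfolding closed_in_def
  proof (intro allI impI, rule ccontr)
    fix x y assume "(x, y) \<in> E" "y \<in> H" "x \<in> X" "y \<notin> X"
    then have "?P (insert y X)" using X by (auto intro: grown.leaf)
    then show False using max \<open>y \<notin> X\<close> by blast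
  qed
  then show ?thesis using X by blast
qed

section \<open>Transforming sequences from balanced cuts\<close>

lemma transforming_sequence_append:
  "transforming_sequence G S ms S' \<Longrightarrow> transforming_sequence G S' ms' T
    \<Longrightarrow> transforming_sequence G S (ms @ ms') T"
  by (induction G S ms S' rule: transforming_sequence.induct) auto

lemma interior_distinct:
  assumes "distinct p" and "x \<in> set (butlast (tl p))"
  shows "x \<in> set p" and "x \<noteq> hd p" and "x \<noteq> last p"
proof -
  obtain a q where p: "p = a # q" using assms(2) by (cases p) auto
  with assms(2) have "q \<noteq> []" by auto
  then obtain q' b where "q = q' @ [b]" by (metis rev_exhaust)
  then show "x \<in> set p" "x \<noteq> hd p" "x \<noteq> last p" using assms p by auto
qed

lemma free_path_rev:
  assumes "sym (parcs G)" and "free_path G C p"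
  shows "free_path G C (rev p)"
proof -
  have "set (vwalk_arcs (rev p)) \<subseteq> parcs G"
    using assms by (auto simp: set_vwalk_arcs_rev free_path_def vpath_def vwalk_def dest: symD)
  moreover have "butlast (tl (rev p)) = rev (butlast (tl p))"
    by (metis butlast_rev butlast_tl rev_rev_ident)
  ultimately show ?thesis using assms(2)
    by (auto simp: free_path_def vpath_def vwalk_def)
qed

text \<open>Nearest means first on some walk: a walk inside \<open>X\<close> is cut at its first
  vertex of \<open>S\<close> and shortened to a path. Its intermediate vertices then avoid
  \<open>S\<close>, and they avoid \<open>W\<close> because they lie in \<open>X\<close>.\<close>

lemma nearest_token:
  assumes gr: "grown (parcs G) r X" and sym: "sym (parcs G)" and XV: "X \<subseteq> pverts G"
    and v: "v \<in> X" "v \<notin> S" and S: "S \<subseteq> X" "S \<noteq> {}" and W: "X \<inter> W = {}"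
  shows "\<exists>s\<in>S. \<exists>p. free_path G (S \<union> W) p \<and> hd p = v \<and> last p = s"
proof -
  let ?R = "{y. \<exists>p. vwalk p (with_proj G) \<and> hd p = v \<and> last p = y \<and> set p \<subseteq> X}"
  have "closed_in (parcs G) X ?R"
    unfolding closed_in_def
  proof (intro allI impI)
    fix x y assume xy: "(x, y) \<in> parcs G" "x \<in> X" "y \<in> X" "x \<in> ?R"
    then obtain p where p: "vwalk p (with_proj G)" "hd p = v" "last p = x" "set p \<subseteq> X" by blast
    then have "p \<noteq> []" by (auto simp: vwalk_def)
    then have "vwalk (p @ [y]) (with_proj G)" using p xy XV
      by (auto simp: vwalk_def vwalk_arcs_append)
    then show "y \<in> ?R" using p xy \<open>p \<noteq> []\<close> by (intro CollectI exI[of _ "p @ [y]"]) auto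
  qed
  moreover have "v \<in> ?R" using v XV by (intro CollectI exI[of _ "[v]"]) (auto simp: vwalk_def)
  ultimately have "X \<subseteq> ?R" using grown_closed[OF gr sym] v by blast
  then obtain s p where p: "vwalk p (with_proj G)" "hd p = v" "set p \<subseteq> X" "last p = s" "s \<in> S"
    using S by blast
  then have "\<exists>x\<in>set p. x \<in> S" by (metis last_in_set vwalk_def)
  then obtain p1 s' p2 where sp: "p = p1 @ s' # p2" "s' \<in> S" "\<forall>x\<in>set p1. x \<notin> S"
    using split_list_first_prop[of p "\<lambda>x. x \<in> S"] by blast
  let ?q = "vwalk_to_vpath (p1 @ [s'])"
  have ne: "p1 \<noteq> []" using sp p v by auto
  have "vwalk (p1 @ [s']) (with_proj G)"
    using p(1) sp(1) vwalkI_append_l[of "p1 @ [s']" p2] by simp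
  then have q: "vpath ?q (with_proj G)" by (rule vwalk_to_vpath_vpath)
  have hq: "hd ?q = v" "last ?q = s'"
    using p(2) sp(1) ne by (auto simp: vwalk_to_vpath_hd vwalk_to_vpath_last simp del: vwalk_to_vpath.simps)
  have "set (butlast (tl ?q)) \<inter> (S \<union> W) = {}"
  proof (intro equals0I)
    fix x assume x: "x \<in> set (butlast (tl ?q)) \<inter> (S \<union> W)"
    have "distinct ?q" using q by (auto simp: vpath_def)
    with x have "x \<in> set ?q" "x \<noteq> s'" using interior_distinct[of ?q x] hq by auto
    then have "x \<in> set p1" using vwalk_to_vpath_subset[of x "p1 @ [s']"] by auto
    then show False using x sp p(3) W by auto
  qed
  then show ?thesis using q hq sp(2) unfolding free_path_def by blast
qed

text \<open>
  The last vertex \<open>v\<close> that was added leaves the rest connected. If only \<open>T\<close> needs a token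
  on \<open>v\<close>, the nearest token moves there for good; if only \<open>S\<close> has one there, the same step is
  performed last and backwards.
\<close>

lemma transform_grown:
  assumes "grown (parcs G) r X" and sym: "sym (parcs G)" and "X \<subseteq> pverts G" "finite X"
    and "S \<subseteq> X" "T \<subseteq> X" "card S = card T" "X \<inter> W = {}"
  shows "\<exists>ms. length ms \<le> card S \<and> transforming_sequence G (S \<union> W) ms (T \<union> W)"
  using assms
proof (induction arbitrary: S T W rule: grown.induct)
  case root
  then have "S = T" by (metis card_subset_eq finite.emptyI finite_insert subset_singletonD)
  then show ?case by (intro exI[of _ "[]"]) auto
next
  case (leaf X u v)
  have gr: "grown (parcs G) r (insert v X)" using leaf.hyps by (rule grown.leaf)
  have fin: "finite S" "finite T" "finite X" using leaf.prems finite_subset by auto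
  have XV: "X \<subseteq> pverts G" "insert v X \<subseteq> pverts G" using leaf.prems by auto
  note IH = leaf.IH[OF sym XV(1) fin(3)]
  have W': "X \<inter> insert v W = {}" using leaf by auto
  consider "v \<notin> S" "v \<notin> T" | "v \<in> S" "v \<in> T" | "v \<notin> S" "v \<in> T" | "v \<in> S" "v \<notin> T" by blast
  then show ?case
  proof cases
    case 1 then show ?thesis using IH[of S T W] leaf.prems by auto
  next
    case 2
    \<comment> \<open>A token already in place is frozen: it joins \<open>W\<close>, and later paths
      avoid it.\<close>
    have "\<exists>ms. length ms \<le> card (S - {v}) \<and>
      transforming_sequence G ((S - {v}) \<union> insert v W) ms ((T - {v}) \<union> insert v W)"
      using leaf.prems 2 W' by (intro IH) (auto simp: card_Diff_singleton)
    moreover have "(S - {v}) \<union> insert v W = S \<union> W" "(T - {v}) \<union> insert v W = T \<union> W" using 2 by auto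
    ultimately show ?thesis by (metis card_Diff1_le order.trans)
  next
    case 3
    have "S \<noteq> {}" using 3 leaf.prems fin by auto
    then obtain s p where s: "s \<in> S" and p: "free_path G (S \<union> W) p" "hd p = v" "last p = s"
      using nearest_token[OF gr sym XV(2), of v S W] leaf.prems 3 by auto
    have "p \<noteq> []" using p by (auto simp: free_path_def vpath_def vwalk_def)
    then have val: "valid_move G (S \<union> W) (s, v)"
      using free_path_rev[OF sym p(1)] p s 3 XV leaf.prems
      by (auto simp: valid_move_def hd_rev last_rev intro!: exI[of _ "rev p"])
    have "\<exists>ms. length ms \<le> card (S - {s}) \<and>
      transforming_sequence G ((S - {s}) \<union> insert v W) ms ((T - {v}) \<union> insert v W)"
      using leaf.prems 3 W' s by (intro IH) (auto simp: card_Diff_singleton)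
    then obtain ms where ms: "length ms \<le> card (S - {s})"
      "transforming_sequence G ((S - {s}) \<union> insert v W) ms ((T - {v}) \<union> insert v W)" by blast
    have eq: "(S - {s}) \<union> insert v W = execute (s, v) (S \<union> W)" "(T - {v}) \<union> insert v W = T \<union> W"
      using 3 s leaf.prems by (auto simp: execute_def)
    have "length ((s, v) # ms) \<le> card S"
      using ms(1) s fin by (metis card_Suc_Diff1 length_Cons Suc_le_mono)
    then show ?thesis using ms val eq by (intro exI[of _ "(s, v) # ms"]) auto
  next
    case 4
    have "T \<noteq> {}" using 4 leaf.prems fin by auto
    then obtain t p where t: "t \<in> T" and p: "free_path G (T \<union> W) p" "hd p = v" "last p = t"
      using nearest_token[OF gr sym XV(2), of v T W] leaf.prems 4 by auto
    have "\<exists>ms. length ms \<le> card (S - {v}) \<and>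
      transforming_sequence G ((S - {v}) \<union> insert v W) ms ((T - {t}) \<union> insert v W)"
      using leaf.prems 4 W' t by (intro IH) (auto simp: card_Diff_singleton)
    then obtain ms where ms: "length ms \<le> card (S - {v})"
      "transforming_sequence G ((S - {v}) \<union> insert v W) ms ((T - {t}) \<union> insert v W)" by blast
    \<comment> \<open>Here \<open>v\<close> is occupied and \<open>t\<close> is vacant. Both are
      ends of the path, so its interior stays free.\<close>
    have "set (butlast (tl p)) \<inter> ((T - {t}) \<union> insert v W) = {}"
      using p interior_distinct[of p] by (auto simp: free_path_def vpath_def)
    then have val: "valid_move G ((T - {t}) \<union> insert v W) (v, t)"
      using p t 4 XV leaf.prems by (auto simp: valid_move_def free_path_def intro!: exI[of _ p])
    have eq: "(S - {v}) \<union> insert v W = S \<union> W" "execute (v, t) ((T - {t}) \<union> insert v W) = T \<union> W"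
      using 4 t leaf.prems by (auto simp: execute_def)
    have "transforming_sequence G (S \<union> W) (ms @ [(v, t)]) (T \<union> W)"
      using transforming_sequence_append[OF ms(2), of "[(v, t)]"] val eq by auto
    moreover have "length (ms @ [(v, t)]) \<le> card S"
      using ms(1) 4 fin by (metis card_Suc_Diff1 length_append_singleton Suc_le_mono)
    ultimately show ?thesis by blast
  qed
qed

text \<open>One component \<open>X\<close> at a time: the tokens outside \<open>X\<close> wait among
  the fixed ones, then the tokens settled in \<open>X\<close> take over that role.\<close>

lemma transform_balanced:
  assumes "finite H" "H \<subseteq> pverts G" and sym: "sym (parcs G)" and "S \<subseteq> H" "T \<subseteq> H"
    and "\<And>K. closed_in (parcs G) H K \<Longrightarrow> card (K \<inter> S) = card (K \<inter> T)" and "H \<inter> W = {}"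
  shows "\<exists>ms. length ms \<le> card S \<and> transforming_sequence G (S \<union> W) ms (T \<union> W)"
  using assms
proof (induction "card H" arbitrary: H S T W rule: less_induct)
  case less
  note bal = less.prems(6)
  have fin: "finite S" "finite T" using less.prems(1,4,5) by (auto intro: finite_subset)
  show ?case
  proof (cases "H = {}")
    case True
    then show ?thesis using less.prems by (intro exI[of _ "[]"]) auto
  next
    case False
    then obtain r X where X: "grown (parcs G) r X" "X \<subseteq> H" "closed_in (parcs G) H X" "r \<in> X"
      using exists_grown_component[OF less.prems(1)] grown_root by (metis all_not_in_conv)
    have "finite X" using X(2) less.prems(1) finite_subset by auto
    have "\<exists>ms. length ms \<le> card (X \<inter> S) \<and>
      transforming_sequence G ((X \<inter> S) \<union> ((S - X) \<union> W)) ms ((X \<inter> T) \<union> ((S - X) \<union> W))"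
      using X less.prems \<open>finite X\<close> bal[OF X(3)] by (intro transform_grown[OF X(1)]) auto
    then obtain ms where ms: "length ms \<le> card (X \<inter> S)"
      "transforming_sequence G ((X \<inter> S) \<union> ((S - X) \<union> W)) ms ((X \<inter> T) \<union> ((S - X) \<union> W))" by blast
    have "\<exists>ms. length ms \<le> card (S - X) \<and>
      transforming_sequence G ((S - X) \<union> ((X \<inter> T) \<union> W)) ms ((T - X) \<union> ((X \<inter> T) \<union> W))"
    proof (rule less.hyps)
      show "card (H - X) < card H"
        using X less.prems(1) by (intro psubset_card_mono) auto
      show "card (K \<inter> (S - X)) = card (K \<inter> (T - X))" if K: "closed_in (parcs G) (H - X) K" for K
      proof -
        \<comment> \<open>Since \<open>X\<close> is closed, no arc inside \<open>H\<close> joins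
          \<open>K - X\<close> to \<open>X\<close>.\<close>
        have "closed_in (parcs G) H (K - X)"
          using K X(3) sym unfolding closed_in_def by (metis DiffE DiffI symD)
        then show ?thesis using bal[of "K - X"] by (metis Int_Diff Diff_Int_distrib2 Int_commute)
      qed
    qed (use X less.prems in auto)
    then obtain ms' where ms': "length ms' \<le> card (S - X)"
      "transforming_sequence G ((S - X) \<union> ((X \<inter> T) \<union> W)) ms' ((T - X) \<union> ((X \<inter> T) \<union> W))" by blast
    have eq: "(X \<inter> S) \<union> ((S - X) \<union> W) = S \<union> W" "(T - X) \<union> ((X \<inter> T) \<union> W) = T \<union> W"
      "(X \<inter> T) \<union> ((S - X) \<union> W) = (S - X) \<union> ((X \<inter> T) \<union> W)" by auto
    have "card S = card (X \<inter> S) + card (S - X)"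
      using card_Int_Diff[OF fin(1), of X] by (simp add: Int_commute)
    then show ?thesis
      using transforming_sequence_append[of G _ ms _ ms'] ms ms' unfolding eq
      by (intro exI[of _ "ms @ ms'"]) auto
  qed
qed

section \<open>Balanced cuts from transforming sequences\<close>

lemma transforming_sequence_sources:
  "transforming_sequence G S ms T \<Longrightarrow> S - T \<subseteq> fst ` set ms"
proof (induction G S ms T rule: transforming_sequence.induct)
  case (2 G S m ms T)
  then show ?case by (fastforce simp: execute_def)
qed auto

lemma vwalk_closed_in:
  assumes "vwalk p (with_proj G)" and "set p \<subseteq> H" and "closed_in (parcs G) H K" and "hd p \<in> K"
  shows "last p \<in> K"
  using assms
proof (induction rule: vwalk_induct)
  case (Cons u v es)
  then show ?case by (auto simp: closed_in_def)
qed auto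

text \<open>The path of a move avoids the resting tokens \<open>F\<close>: its interior and its
  target carry no token, and its source is not in \<open>F\<close>. Hence source and target lie on
  the same side of the cut \<open>K\<close>.\<close>

lemma execute_card_closed_in:
  assumes sym: "sym (parcs G)" and val: "valid_move G C m" and F: "F \<subseteq> C" "fst m \<notin> F"
    and K: "closed_in (parcs G) (pverts G - F) K" and fin: "finite C"
  shows "card (K \<inter> execute m C) = card (K \<inter> C)" and "F \<subseteq> execute m C"
proof -
  obtain s t where m: "m = (s, t)" by (cases m)
  obtain p where p: "free_path G C p" "hd p = s" "last p = t" and st: "s \<in> C" "t \<notin> C"
    using val by (auto simp: valid_move_def m)
  have ne: "p \<noteq> []" using p by (auto simp: free_path_def vpath_def vwalk_def)
  have "set p \<subseteq> insert s (insert t (set (butlast (tl p))))"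
    using ne p(2,3) by (cases p; cases "tl p" rule: rev_cases) auto
  moreover have "set p \<subseteq> pverts G" "set (butlast (tl p)) \<inter> F = {}" "s \<notin> F" "t \<notin> F"
    using p st F by (auto simp: free_path_def vpath_def vwalk_def m)
  ultimately have pH: "set p \<subseteq> pverts G - F" by blast
  have w: "vwalk p (with_proj G)" using p by (auto simp: free_path_def vpath_def)
  have "s \<in> K \<Longrightarrow> t \<in> K" using vwalk_closed_in[OF w pH K] p by simp
  moreover have "s \<in> - K \<Longrightarrow> t \<in> - K"
    using vwalk_closed_in[OF w pH closed_in_Compl[OF sym K]] p by simp
  ultimately have iff: "s \<in> K \<longleftrightarrow> t \<in> K" by blast
  show "card (K \<inter> execute m C) = card (K \<inter> C)"
  proof (cases "s \<in> K")
    case True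
    then have "K \<inter> execute m C = insert t ((K \<inter> C) - {s})" using iff by (auto simp: m execute_def)
    moreover have "t \<notin> (K \<inter> C) - {s}" using st by auto
    ultimately show ?thesis using True st fin
      by (simp add: card_Suc_Diff1 del: card_Diff_insert)
  next
    case False
    then have "K \<inter> execute m C = K \<inter> C" using iff by (auto simp: m execute_def)
    then show ?thesis by simp
  qed
  show "F \<subseteq> execute m C" using F by (auto simp: m execute_def)
qed

lemma transforming_sequence_balanced:
  assumes "transforming_sequence G S ms T" and "sym (parcs G)" and "finite S"
    and "F \<subseteq> S" and "F \<inter> fst ` set ms = {}" and "closed_in (parcs G) (pverts G - F) K"
  shows "card (K \<inter> S) = card (K \<inter> T)"
  using assms
proof (induction G S ms T rule: transforming_sequence.induct)
  case (2 G S m ms T)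
  have ex: "card (K \<inter> execute m S) = card (K \<inter> S)" "F \<subseteq> execute m S"
    using execute_card_closed_in[of G S m F K] 2 by auto
  have "finite (execute m S)" using 2 by (simp add: execute_def)
  then show ?case using 2 ex by auto
qed auto

lemma card_Int_Diff_iff:
  assumes "finite S" "finite T"
  shows "card (K \<inter> S) = card (K \<inter> T) \<longleftrightarrow> card (K \<inter> (S - T)) = card (K \<inter> (T - S))"
proof -
  have "card (K \<inter> S) = card (K \<inter> S \<inter> T) + card (K \<inter> (S - T))"
    using card_Int_Diff[of "K \<inter> S" T] assms by (simp add: Int_Diff)
  moreover have "card (K \<inter> T) = card (K \<inter> S \<inter> T) + card (K \<inter> (T - S))"
    using card_Int_Diff[of "K \<inter> T" S] assms by (simp add: Int_Diff Int_ac)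
  ultimately show ?thesis by simp
qed

theorem transforming_sequence_iff_balanced:
  assumes G: "pair_graph G" and ST: "S \<subseteq> pverts G" "T \<subseteq> pverts G"
  shows "(\<exists>ms. transforming_sequence G S ms T \<and> length ms \<le> l) \<longleftrightarrow>
    (\<exists>O' \<subseteq> S \<inter> T. card (S - T) + card O' \<le> l \<and>
      (\<forall>K. closed_in (parcs G) (pverts G - (S \<inter> T - O')) K \<longrightarrow>
        card (K \<inter> (S - T)) = card (K \<inter> (T - S))))"
    (is "?L \<longleftrightarrow> ?R")
proof -
  interpret pair_graph G by (fact G)
  have sym: "sym (parcs G)"
    using pair_sym_arcs by (auto simp: symmetric_def)
  have fin: "finite S" "finite T" using ST pair_finite_verts finite_subset by blast+
  show ?thesis
  proof
    assume ?L
    then obtain ms where ms: "transforming_sequence G S ms T" "length ms \<le> l" by blast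
    \<comment> \<open>Every vertex of \<open>S - T\<close> and every obstacle in \<open>?O\<close>
      is the source of some move, and distinct sources need distinct moves.\<close>
    let ?O = "S \<inter> T \<inter> fst ` set ms"
    have "card (S - T) + card ?O = card ((S - T) \<union> ?O)"
      using fin by (subst card_Un_disjoint) auto
    also have "\<dots> \<le> card (fst ` set ms)"
      using transforming_sequence_sources[OF ms(1)] by (intro card_mono) auto
    also have "\<dots> \<le> l" using ms(2) card_image_le[of "set ms" fst] card_length[of ms] by simp
    finally have "card (S - T) + card ?O \<le> l" .
    moreover have "card (K \<inter> (S - T)) = card (K \<inter> (T - S))"
      if "closed_in (parcs G) (pverts G - (S \<inter> T - ?O)) K" for K
      using transforming_sequence_balanced[OF ms(1) sym fin(1) _ _ that] fin
      by (subst card_Int_Diff_iff[symmetric]) auto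
    ultimately show ?R by (intro exI[of _ ?O]) auto
  next
    assume ?R
    then obtain O' where O': "O' \<subseteq> S \<inter> T" "card (S - T) + card O' \<le> l"
      and bal: "\<And>K. closed_in (parcs G) (pverts G - (S \<inter> T - O')) K \<Longrightarrow>
        card (K \<inter> (S - T)) = card (K \<inter> (T - S))" by blast
    let ?S = "(S - T) \<union> O'" and ?T = "(T - S) \<union> O'" and ?W = "S \<inter> T - O'"
    have finO: "finite O'" using O' fin finite_subset by blast
    have "\<exists>ms. length ms \<le> card ?S \<and> transforming_sequence G (?S \<union> ?W) ms (?T \<union> ?W)"
    proof (rule transform_balanced)
      show "card (K \<inter> ?S) = card (K \<inter> ?T)" if "closed_in (parcs G) (pverts G - ?W) K" for K
      proof -
        \<comment> \<open>The moved obstacles occur in both sets and cancel from the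
          differences.\<close>
        have "?S - ?T = S - T" "?T - ?S = T - S" using O' by auto
        then show ?thesis using bal[OF that] card_Int_Diff_iff[of ?S ?T K] fin finO by simp
      qed
    qed (use ST O' pair_finite_verts sym in auto)
    moreover have "?S \<union> ?W = S" "?T \<union> ?W = T" using O' by auto
    moreover have "card ?S \<le> l" using O' card_Un_le[of "S - T" O'] by linarith
    ultimately show ?L by (metis order.trans)
  qed
qed

section \<open>Derivations of connected terminals\<close>

type_synonym 'a item = "(bool \<times> 'a) option"

definition weight :: "'a set \<Rightarrow> 'a item \<Rightarrow> int" where
  "weight K i = (case i of None \<Rightarrow> 0 | Some (b, v) \<Rightarrow> if v \<in> K then (if b then 1 else -1) else 0)"

text \<open>Terminals inside \<open>K\<close> counted with sign: those tagged \<open>True\<close>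
  stand for \<open>S - T\<close>, those tagged \<open>False\<close> for \<open>T - S\<close>.
  Additivity in the multiset makes it compatible with joining derivations.\<close>

definition excess :: "'a set \<Rightarrow> 'a item multiset \<Rightarrow> int" where
  "excess K M = \<Sum>\<^sub># (image_mset (weight K) M)"

lemma weight_None [simp]: "weight K None = 0"
  by (simp add: weight_def)

lemma excess_simps [simp]:
  "excess K {#} = 0" "excess K (add_mset i M) = weight K i + excess K M"
  "excess K (M + N) = excess K M + excess K N"
  by (simp_all add: excess_def)

lemma excess_replicate_None [simp]: "excess K (replicate_mset n None) = 0"
  by (induction n) auto

text \<open>If the total excess is 0, a cut and its complement are balanced together, so that cuts
  may be taken to avoid a chosen vertex.\<close>

lemma excess_Compl: "excess (- K) M = excess UNIV M - excess K M"
  by (induction M) (auto simp: weight_def split: option.splits)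

text \<open>
  An item \<open>None\<close> pays for one vertex of \<open>Z\<close>. The vertex \<open>v\<close> itself is not paid for in \<open>derivable E Z M v\<close>,
  so that joining two derivations at \<open>v\<close> does not pay twice.
\<close>

inductive derivable :: "'a rel \<Rightarrow> 'a set \<Rightarrow> 'a item multiset \<Rightarrow> 'a \<Rightarrow> bool" for E Z where
  terminal: "derivable E Z {#Some (b, v)#} v"
| free_step: "derivable E Z M v \<Longrightarrow> v \<notin> Z \<Longrightarrow> (v, u) \<in> E \<Longrightarrow> derivable E Z M u"
| paid_step: "derivable E Z M v \<Longrightarrow> (v, u) \<in> E \<Longrightarrow> derivable E Z (add_mset None M) u"
| weaken: "derivable E Z M v \<Longrightarrow> derivable E Z (add_mset None M) v"
| join: "derivable E Z M v \<Longrightarrow> derivable E Z N v \<Longrightarrow> derivable E Z (M + N) v"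
| jump: "derivable E Z M w \<Longrightarrow> w \<notin> Z \<Longrightarrow> excess UNIV M = 0 \<Longrightarrow> derivable E Z N v \<Longrightarrow>
    derivable E Z (M + N) v"

section \<open>Soundness of derivations\<close>

lemma derivable_nonempty: "derivable E Z M v \<Longrightarrow> M \<noteq> {#}"
  by (induction rule: derivable.induct) auto

text \<open>\<open>P\<close> collects the obstacles paid for. The current root is unpaid and hence
  made passable by \<open>insert v\<close>. A cut avoiding it misses the terminals connected to it,
  and the parts left behind by a jump contribute 0.\<close>

lemma derivable_sound:
  assumes "derivable E Z M v" and "sym E"
  shows "\<exists>P \<subseteq> Z. finite P \<and> card P \<le> count M None \<and>
    (\<forall>K. closed_in E (insert v (- (Z - P))) K \<longrightarrow> v \<notin> K \<longrightarrow> excess K M = 0)"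
  using assms
proof (induction rule: derivable.induct)
  case (terminal b v)
  then show ?case by (intro exI[of _ "{}"]) (auto simp: weight_def)
next
  case (free_step M v u)
  then obtain P where P: "P \<subseteq> Z" "finite P" "card P \<le> count M None"
    "\<And>K. closed_in E (insert v (- (Z - P))) K \<Longrightarrow> v \<notin> K \<Longrightarrow> excess K M = 0" by auto
  have "excess K M = 0" if K: "closed_in E (insert u (- (Z - P))) K" "u \<notin> K" for K
  proof (rule P(4))
    show "closed_in E (insert v (- (Z - P))) K" using K(1) free_step.hyps by (elim closed_in_mono) auto
    show "v \<notin> K" using K free_step.hyps unfolding closed_in_def by blast
  qed
  then show ?case using P by blast
next
  case (paid_step M v u)
  then obtain P where P: "P \<subseteq> Z" "finite P" "card P \<le> count M None"
    "\<And>K. closed_in E (insert v (- (Z - P))) K \<Longrightarrow> v \<notin> K \<Longrightarrow> excess K M = 0" by auto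
  \<comment> \<open>The old root \<open>v\<close> loses its exemption, so it enters \<open>P\<close>
    if it is an obstacle; the added \<open>None\<close> pays for it.\<close>
  let ?P = "P \<union> ({v} \<inter> Z)"
  have "card ?P \<le> count (add_mset None M) None"
    using P card_Un_le[of P "{v} \<inter> Z"] card_mono[of "{v}" "{v} \<inter> Z"] by auto
  moreover have "excess K (add_mset None M) = 0"
    if K: "closed_in E (insert u (- (Z - ?P))) K" "u \<notin> K" for K
  proof -
    have "closed_in E (insert v (- (Z - P))) K" using K(1) by (elim closed_in_mono) auto
    moreover have "v \<notin> K" using K paid_step.hyps unfolding closed_in_def by blast
    ultimately show ?thesis using P(4) by simp
  qed
  ultimately show ?case using P by (intro exI[of _ ?P]) auto
next
  case (weaken M v)
  then show ?case by (auto intro: le_SucI)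
next
  case (join M v N)
  then obtain P Q where P: "P \<subseteq> Z" "finite P" "card P \<le> count M None"
    "\<And>K. closed_in E (insert v (- (Z - P))) K \<Longrightarrow> v \<notin> K \<Longrightarrow> excess K M = 0"
    and Q: "Q \<subseteq> Z" "finite Q" "card Q \<le> count N None"
    "\<And>K. closed_in E (insert v (- (Z - Q))) K \<Longrightarrow> v \<notin> K \<Longrightarrow> excess K N = 0" by auto
  have "excess K (M + N) = 0" if K: "closed_in E (insert v (- (Z - (P \<union> Q)))) K" "v \<notin> K" for K
  proof -
    have "closed_in E (insert v (- (Z - P))) K" "closed_in E (insert v (- (Z - Q))) K"
      using K(1) by (auto elim!: closed_in_mono)
    then show ?thesis using P(4) Q(4) K by simp
  qed
  moreover have "card (P \<union> Q) \<le> count (M + N) None" using P Q card_Un_le[of P Q] by auto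
  ultimately show ?case using P Q by (intro exI[of _ "P \<union> Q"]) auto
next
  case (jump M w N v)
  then obtain P Q where P: "P \<subseteq> Z" "finite P" "card P \<le> count M None"
    "\<And>K. closed_in E (insert w (- (Z - P))) K \<Longrightarrow> w \<notin> K \<Longrightarrow> excess K M = 0"
    and Q: "Q \<subseteq> Z" "finite Q" "card Q \<le> count N None"
    "\<And>K. closed_in E (insert v (- (Z - Q))) K \<Longrightarrow> v \<notin> K \<Longrightarrow> excess K N = 0" by auto
  have "excess K (M + N) = 0" if K: "closed_in E (insert v (- (Z - (P \<union> Q)))) K" "v \<notin> K" for K
  proof -
    have c: "closed_in E (insert w (- (Z - P))) K" "closed_in E (insert v (- (Z - Q))) K"
      using K(1) jump.hyps(2) by (auto elim!: closed_in_mono)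
    \<comment> \<open>The part left behind has total excess 0, so passing to the complement settles
      the case that \<open>K\<close> contains its root.\<close>
    have "excess K M = 0"
    proof (cases "w \<in> K")
      case True
      then have "excess (- K) M = 0"
        using P(4)[OF closed_in_Compl[OF \<open>sym E\<close> c(1)]] by simp
      then show ?thesis using jump.hyps(3) by (simp add: excess_Compl)
    qed (use P(4) c in blast)
    then show ?thesis using Q(4) c K by simp
  qed
  moreover have "card (P \<union> Q) \<le> count (M + N) None" using P Q card_Un_le[of P Q] by auto
  ultimately show ?case using P Q by (intro exI[of _ "P \<union> Q"]) auto
qed

text \<open>A free root needs no exemption, and total excess 0 removes the restriction to cuts
  avoiding it.\<close>

lemma derivable_sound_free:
  assumes "derivable E Z M v" and "sym E" and "v \<notin> Z" and "excess UNIV M = 0"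
  shows "\<exists>P \<subseteq> Z. finite P \<and> card P \<le> count M None \<and>
    (\<forall>K. closed_in E (- (Z - P)) K \<longrightarrow> excess K M = 0)"
proof -
  obtain P where P: "P \<subseteq> Z" "finite P" "card P \<le> count M None"
    "\<And>K. closed_in E (insert v (- (Z - P))) K \<Longrightarrow> v \<notin> K \<Longrightarrow> excess K M = 0"
    using derivable_sound[OF assms(1,2)] by auto
  have "insert v (- (Z - P)) = - (Z - P)" using assms(3) by auto
  then have P': "closed_in E (- (Z - P)) K \<Longrightarrow> v \<notin> K \<Longrightarrow> excess K M = 0" for K
    using P(4) by simp
  have "excess K M = 0" if K: "closed_in E (- (Z - P)) K" for K
  proof (cases "v \<in> K")
    case True
    then have "excess (- K) M = 0" using P'[OF closed_in_Compl[OF assms(2) K]] by simp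
    then show ?thesis using assms(4) by (simp add: excess_Compl)
  qed (use P' K in blast)
  then show ?thesis using P by blast
qed

section \<open>Completeness of derivations\<close>

definition items_on :: "'a item multiset \<Rightarrow> 'a set \<Rightarrow> 'a item multiset" where
  "items_on M X = {#i \<in># M. \<exists>b v. i = Some (b, v) \<and> v \<in> X#}"

lemma items_on_Un: "X \<inter> Y = {} \<Longrightarrow> items_on M (X \<union> Y) = items_on M X + items_on M Y"
  unfolding items_on_def by (induction M) auto

lemma excess_items_on: "excess UNIV (items_on M X) = excess X M"
  unfolding items_on_def by (induction M) (auto simp: weight_def split: option.splits)

lemma derivable_weaken: "derivable E Z M v \<Longrightarrow> derivable E Z (M + replicate_mset k None) v"
  by (induction k) (auto intro: derivable.weaken)

lemma derivable_step:
  assumes "derivable E Z M u" and "(u, v) \<in> E"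
  shows "derivable E Z (M + replicate_mset (card (Z \<inter> {u})) None) v"
  using assms by (cases "u \<in> Z") (auto intro: derivable.intros)

lemma derivable_items_on_singleton:
  "items_on M {v} \<noteq> {#} \<Longrightarrow> derivable E Z (items_on M {v}) v"
proof (induction M)
  case (add i M)
  show ?case
  proof (cases "\<exists>b. i = Some (b, v)")
    case True
    then obtain b where b: "i = Some (b, v)" by blast
    then have eq: "items_on (add_mset i M) {v} = {#Some (b, v)#} + items_on M {v}"
      by (simp add: items_on_def)
    show ?thesis
    proof (cases "items_on M {v} = {#}")
      case True then show ?thesis using eq by (simp add: derivable.terminal)
    next
      case False
      then show ?thesis using add.IH unfolding eq by (intro derivable.join derivable.terminal)
    qed
  next
    case False
    then have "items_on (add_mset i M) {v} = items_on M {v}" by (auto simp: items_on_def)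
    then show ?thesis using add by simp
  qed
qed (simp add: items_on_def)

text \<open>A spanning tree split at an arc into its root, which is the shape of a step followed by
  a join. The leaf additions of \<open>grown\<close> do not fit here, because derivations travel
  towards the root.\<close>

inductive rooted :: "'a rel \<Rightarrow> 'a set \<Rightarrow> 'a \<Rightarrow> bool" for E where
  single: "rooted E {v} v"
| attach: "rooted E X v \<Longrightarrow> rooted E Y u \<Longrightarrow> (u, v) \<in> E \<Longrightarrow> X \<inter> Y = {} \<Longrightarrow> rooted E (X \<union> Y) v"

lemma rooted_finite: "rooted E X v \<Longrightarrow> finite X \<and> v \<in> X"
  by (induction rule: rooted.induct) auto

lemma rooted_insert:
  assumes "rooted E X r" and "u \<in> X" and "v \<notin> X" and "(v, u) \<in> E"
  shows "rooted E (insert v X) r"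
  using assms
proof (induction rule: rooted.induct)
  case (single w)
  then show ?case using rooted.attach[OF rooted.single rooted.single, of v w] by (simp add: insert_commute)
next
  case (attach X w Y u')
  show ?case
  proof (cases "u \<in> X")
    case True
    then have "rooted E (insert v X \<union> Y) w"
      using attach by (intro rooted.attach[of _ _ _ _ u']) auto
    then show ?thesis by simp
  next
    case False
    then have "rooted E (X \<union> insert v Y) w"
      using attach by (intro rooted.attach[of _ _ _ _ u']) auto
    then show ?thesis by simp
  qed
qed

lemma grown_rooted: "grown E r X \<Longrightarrow> sym E \<Longrightarrow> rooted E X r"
proof (induction rule: grown.induct)
  case (leaf X u v)
  then show ?case by (blast intro: rooted_insert dest: symD)
qed (rule rooted.single)

text \<open>The cost covers every obstacle of \<open>X\<close> but the root, as derivations do not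
  pay for their root. A half without terminals has no derivation, so its share of the budget is
  spent by weakening.\<close>

lemma derivable_rooted:
  assumes "rooted E X v" and "items_on M X \<noteq> {#}"
  shows "derivable E Z (items_on M X + replicate_mset (card (X \<inter> Z - {v})) None) v"
  using assms
proof (induction rule: rooted.induct)
  case (single v)
  have "card ({v} \<inter> Z - {v}) = 0" by auto
  then show ?case using derivable_items_on_singleton[OF single, of E Z] by (simp only: replicate_mset_0 add_0_right)
next
  case (attach X v Y u)
  have fin: "finite X" "v \<in> X" "finite Y" "u \<in> Y" using attach.hyps(1,2)[THEN rooted_finite] by auto
  let ?r = "\<lambda>k. replicate_mset k None"
  \<comment> \<open>The root \<open>u\<close> is exempt inside \<open>Y\<close> and paid for, if it
    is an obstacle, on the step to \<open>v\<close>.\<close>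
  have "(X \<union> Y) \<inter> Z - {v} = (X \<inter> Z - {v}) \<union> (Y \<inter> Z - {u}) \<union> (Z \<inter> {u})"
    using attach.hyps fin by auto
  moreover have "card \<dots> = card (X \<inter> Z - {v}) + card (Y \<inter> Z - {u}) + card (Z \<inter> {u})"
    using attach.hyps fin by (subst card_Un_disjoint; (subst card_Un_disjoint)?) auto
  ultimately have card: "?r (card ((X \<union> Y) \<inter> Z - {v})) =
      ?r (card (X \<inter> Z - {v})) + (?r (card (Y \<inter> Z - {u})) + ?r (card (Z \<inter> {u})))"
    by (simp add: multiset_eq_iff)
  note items = items_on_Un[OF attach.hyps(4), of M]
  have Y: "derivable E Z (items_on M Y + ?r (card (Y \<inter> Z - {u})) + ?r (card (Z \<inter> {u}))) v"
    if "items_on M Y \<noteq> {#}"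
    using derivable_step[OF attach.IH(2)[OF that] attach.hyps(3)] .
  consider "items_on M Y = {#}" "items_on M X \<noteq> {#}" | "items_on M X = {#}" "items_on M Y \<noteq> {#}"
    | "items_on M X \<noteq> {#}" "items_on M Y \<noteq> {#}"
    using attach.prems items by auto
  then show ?case
  proof cases
    case 1
    then show ?thesis
      using derivable_weaken[OF derivable_weaken[OF attach.IH(1)], of "card (Y \<inter> Z - {u})" "card (Z \<inter> {u})"]
      unfolding items card by (simp add: ac_simps)
  next
    case 2
    then show ?thesis
      using derivable_weaken[OF Y, of "card (X \<inter> Z - {v})"]
      unfolding items card by (simp add: ac_simps)
  next
    case 3
    then show ?thesis
      using derivable.join[OF attach.IH(1) Y] unfolding items card by (simp add: ac_simps)
  qed
qed

text \<open>A component containing a terminal is rooted there. Terminals are free, so all obstacles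
  of the component are paid. Being closed, it is balanced and may be left behind by a jump to the
  rest.\<close>

lemma derivable_complete:
  assumes "finite H" and sym: "sym E" and free: "\<And>b v. Some (b, v) \<in># M \<Longrightarrow> v \<notin> Z"
    and "items_on M H \<noteq> {#}"
    and "\<And>K. closed_in E H K \<Longrightarrow> K \<subseteq> H \<Longrightarrow> excess K M = 0"
  shows "\<exists>v\<in>H. v \<notin> Z \<and> derivable E Z (items_on M H + replicate_mset (card (H \<inter> Z)) None) v"
  using assms(1,4,5)
proof (induction "card H" arbitrary: H rule: less_induct)
  case less
  let ?r = "\<lambda>k. replicate_mset k None"
  obtain b r where r: "Some (b, r) \<in># M" "r \<in> H"
    using less.prems(2) by (auto simp: items_on_def filter_mset_eq_conv)
  obtain X where X: "grown E r X" "X \<subseteq> H" "closed_in E H X"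
    using exists_grown_component[OF less.prems(1) r(2)] by blast
  have rX: "r \<in> X" using grown_root[OF X(1)] .
  have rZ: "r \<notin> Z" using free r by blast
  have "items_on M X \<noteq> {#}" using r rX by (auto simp: items_on_def filter_mset_eq_conv)
  then have "derivable E Z (items_on M X + ?r (card (X \<inter> Z - {r}))) r"
    by (rule derivable_rooted[OF grown_rooted[OF X(1) sym]])
  then have dX: "derivable E Z (items_on M X + ?r (card (X \<inter> Z))) r" using rZ by simp
  have HX: "X \<union> (H - X) = H" using X by auto
  have items: "items_on M H = items_on M X + items_on M (H - X)"
    using items_on_Un[of X "H - X" M] HX by auto
  have "card (H \<inter> Z) = card (X \<inter> Z) + card ((H - X) \<inter> Z)"
    using less.prems(1) X(2) HX finite_subset[OF X(2) less.prems(1)]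
    by (subst card_Un_disjoint[symmetric]) (auto intro: arg_cong[of _ _ card])
  then have card: "?r (card (H \<inter> Z)) = ?r (card (X \<inter> Z)) + ?r (card ((H - X) \<inter> Z))"
    by (simp add: multiset_eq_iff)
  show ?case
  proof (cases "items_on M (H - X) = {#}")
    case True
    then have "derivable E Z (items_on M H + ?r (card (H \<inter> Z))) r"
      using derivable_weaken[OF dX, of "card ((H - X) \<inter> Z)"] unfolding items card
      by (simp add: ac_simps)
    then show ?thesis using r rZ by blast
  next
    case False
    have "\<exists>v\<in>H - X. v \<notin> Z \<and> derivable E Z (items_on M (H - X) + ?r (card ((H - X) \<inter> Z))) v"
    proof (rule less.hyps)
      show "card (H - X) < card H" using X(2) rX less.prems(1) by (intro psubset_card_mono) auto
      show "excess K M = 0" if K: "closed_in E (H - X) K" "K \<subseteq> H - X" for K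
      proof (rule less.prems(3))
        show "closed_in E H K"
          using K X(3) sym unfolding closed_in_def by (metis DiffD2 DiffI subsetD symD)
      qed (use K in auto)
    qed (use less.prems False in auto)
    then obtain v where v: "v \<in> H - X" "v \<notin> Z"
      "derivable E Z (items_on M (H - X) + ?r (card ((H - X) \<inter> Z))) v" by blast
    have "excess UNIV (items_on M X + ?r (card (X \<inter> Z))) = 0"
      using less.prems(3)[OF X(3,2)] by (simp add: excess_items_on)
    then have "derivable E Z (items_on M H + ?r (card (H \<inter> Z))) v"
      using derivable.jump[OF dX rZ _ v(3)] unfolding items card by (simp add: ac_simps)
    then show ?thesis using v by blast
  qed
qed

theorem derivable_iff_balanced:
  assumes fin: "finite V" and E: "E \<subseteq> V \<times> V" "sym E" and Z: "Z \<subseteq> V"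
    and M: "None \<notin># M" "\<And>b v. Some (b, v) \<in># M \<Longrightarrow> v \<in> V - Z" "M \<noteq> {#}" "excess UNIV M = 0"
  shows "(\<exists>v\<in>V - Z. derivable E Z (replicate_mset k None + M) v) \<longleftrightarrow>
    (\<exists>P \<subseteq> Z. card P \<le> k \<and> (\<forall>K. closed_in E (V - (Z - P)) K \<longrightarrow> excess K M = 0))"
    (is "?L \<longleftrightarrow> ?R")
proof
  assume ?L
  then obtain v where v: "v \<notin> Z" "derivable E Z (replicate_mset k None + M) v" by blast
  have "count (replicate_mset k None + M) None = k" using M(1) by (simp add: not_in_iff)
  then obtain P where P: "P \<subseteq> Z" "card P \<le> k"
    "\<And>K. closed_in E (- (Z - P)) K \<Longrightarrow> excess K M = 0"
    using derivable_sound_free[OF v(2) E(2) v(1)] M(4) by auto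
  \<comment> \<open>All arcs run inside \<open>V\<close>, so elements of the type outside
    \<open>V\<close> impose no condition.\<close>
  moreover have "closed_in E (- (Z - P)) K" if "closed_in E (V - (Z - P)) K" for K
    using that E(1) unfolding closed_in_def by blast
  ultimately show ?R by blast
next
  assume ?R
  then obtain P where P: "P \<subseteq> Z" "card P \<le> k"
    "\<And>K. closed_in E (V - (Z - P)) K \<Longrightarrow> excess K M = 0" by blast
  let ?H = "V - (Z - P)"
  have "i \<in># M \<Longrightarrow> \<exists>b v. i = Some (b, v) \<and> v \<in> ?H" for i using M(1,2) by (cases i) auto
  then have items: "items_on M ?H = M" by (auto simp: items_on_def filter_mset_eq_conv)
  obtain v where v: "v \<in> ?H" "v \<notin> Z" "derivable E Z (M + replicate_mset (card (?H \<inter> Z)) None) v"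
    using derivable_complete[of ?H E M Z] fin E(2) M P(3) items by auto
  have "?H \<inter> Z = P" using P(1) Z by auto
  moreover have "M + replicate_mset (card P) None + replicate_mset (k - card P) None =
      replicate_mset k None + M"
    using P(2) by (simp add: multiset_eq_iff)
  ultimately have "derivable E Z (replicate_mset k None + M) v"
    using derivable_weaken[OF v(3), of "k - card P"] by (simp only:)
  then show ?L using v by blast
qed

section \<open>Evaluation of programs\<close>

text \<open>Weakest preconditions whose postcondition also sees the step count. The simplification
  rules below execute a body symbolically and stop at calls, where \<open>applies\<close> is met by
  a \<open>computes\<close> fact.\<close>

definition wp :: "prog \<Rightarrow> dtree list \<Rightarrow> exp \<Rightarrow> (dtree \<Rightarrow> nat \<Rightarrow> bool) \<Rightarrow> bool" where
  "wp P vs e Q \<longleftrightarrow> (\<exists>v n. eval P vs e v n \<and> Q v n)"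

definition wps :: "prog \<Rightarrow> dtree list \<Rightarrow> exp list \<Rightarrow> (dtree list \<Rightarrow> nat \<Rightarrow> bool) \<Rightarrow> bool" where
  "wps P vs es Q \<longleftrightarrow> (\<exists>ws n. evals P vs es ws n \<and> Q ws n)"

definition applies :: "prog \<Rightarrow> nat \<Rightarrow> dtree list \<Rightarrow> (dtree \<Rightarrow> nat \<Rightarrow> bool) \<Rightarrow> bool" where
  "applies P f ws Q \<longleftrightarrow> f < length P \<and> wp P ws (P ! f) Q"

text \<open>The value is exact but the cost only an upper bound, so that bounds can be rounded up
  along the way.\<close>

definition computes :: "prog \<Rightarrow> nat \<Rightarrow> dtree list \<Rightarrow> dtree \<Rightarrow> nat \<Rightarrow> bool" where
  "computes P f ws v N \<longleftrightarrow> applies P f ws (\<lambda>v' n. v' = v \<and> n \<le> N)"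

lemma wp_Var [simp]: "wp P vs (Var i) Q \<longleftrightarrow> i < length vs \<and> Q (vs ! i) 1"
  unfolding wp_def by (metis eval_VarE eval_evals.Var)

lemma wp_LeafE [simp]: "wp P vs LeafE Q \<longleftrightarrow> Q Leaf 1"
  unfolding wp_def by (metis eval_LeafEE eval_evals.LeafE)

lemma wp_NodeE [simp]:
  "wp P vs (NodeE a b) Q \<longleftrightarrow> wp P vs a (\<lambda>x m. wp P vs b (\<lambda>y n. Q (Node x y) (m + n + 1)))"
proof -
  have "eval P vs (NodeE a b) v k \<longleftrightarrow>
      (\<exists>x m y n. v = Node x y \<and> k = m + n + 1 \<and> eval P vs a x m \<and> eval P vs b y n)" for v k
    by (auto elim!: eval_NodeEE intro: eval_evals.NodeE[simplified])
  then show ?thesis unfolding wp_def by fastforce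
qed

lemma wp_LeftE [simp]: "wp P vs (LeftE a) Q \<longleftrightarrow> wp P vs a (\<lambda>x m. Q (left x) (m + 1))"
proof -
  have "eval P vs (LeftE a) v k \<longleftrightarrow> (\<exists>x m. v = left x \<and> k = m + 1 \<and> eval P vs a x m)" for v k
    by (auto elim!: eval_LeftEE intro: eval_evals.LeftE[simplified])
  then show ?thesis unfolding wp_def by fastforce
qed

lemma wp_RightE [simp]: "wp P vs (RightE a) Q \<longleftrightarrow> wp P vs a (\<lambda>x m. Q (right x) (m + 1))"
proof -
  have "eval P vs (RightE a) v k \<longleftrightarrow> (\<exists>x m. v = right x \<and> k = m + 1 \<and> eval P vs a x m)" for v k
    by (auto elim!: eval_RightEE intro: eval_evals.RightE[simplified])
  then show ?thesis unfolding wp_def by fastforce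
qed

lemma wp_If [simp]:
  "wp P vs (If c a b) Q \<longleftrightarrow>
    wp P vs c (\<lambda>x m. if x = Leaf then wp P vs b (\<lambda>v n. Q v (m + n + 1))
      else wp P vs a (\<lambda>v n. Q v (m + n + 1)))"
proof -
  have "eval P vs (If c a b) v k \<longleftrightarrow> (\<exists>x m n. k = m + n + 1 \<and> eval P vs c x m \<and>
      (if x = Leaf then eval P vs b v n else eval P vs a v n))" for v k
    by (auto elim!: eval_IfE intro: eval_evals.If_true[simplified] eval_evals.If_false[simplified]
        split: if_splits)
  then show ?thesis unfolding wp_def by (fastforce split: if_splits)
qed

lemma wp_Call [simp]:
  "wp P vs (Call f es) Q \<longleftrightarrow> wps P vs es (\<lambda>ws m. applies P f ws (\<lambda>v n. Q v (m + n + 1)))"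
proof -
  have "eval P vs (Call f es) v k \<longleftrightarrow> (\<exists>ws m n. k = m + n + 1 \<and> evals P vs es ws m \<and>
      f < length P \<and> eval P ws (P ! f) v n)" for v k
    by (auto elim!: eval_CallE intro: eval_evals.Call[simplified])
  then show ?thesis unfolding wp_def wps_def applies_def by fastforce
qed

lemma wps_Nil [simp]: "wps P vs [] Q \<longleftrightarrow> Q [] 0"
  unfolding wps_def by (metis evals_NilE eval_evals.Nil)

lemma wps_Cons [simp]:
  "wps P vs (e # es) Q \<longleftrightarrow> wp P vs e (\<lambda>v m. wps P vs es (\<lambda>ws n. Q (v # ws) (m + n)))"
proof -
  have "evals P vs (e # es) vws k \<longleftrightarrow> (\<exists>v ws m n. vws = v # ws \<and> k = m + n \<and>
      eval P vs e v m \<and> evals P vs es ws n)" for vws k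
    by (auto elim!: evals_ConsE intro: eval_evals.Cons)
  then show ?thesis unfolding wp_def wps_def by fastforce
qed

lemma applies_if_computes:
  "computes P f ws v N \<Longrightarrow> (\<And>n. n \<le> N \<Longrightarrow> Q v n) \<Longrightarrow> applies P f ws Q"
  unfolding computes_def applies_def wp_def by blast

lemma computes_mono: "computes P f ws v N \<Longrightarrow> N \<le> N' \<Longrightarrow> computes P f ws v N'"
  unfolding computes_def applies_def wp_def by fastforce

text \<open>The 2 additional steps evaluate the argument and perform the call.\<close>

lemma runs_if_computes: "computes P 0 [x] v N \<Longrightarrow> \<exists>n \<le> N + 2. runs P x v n"
proof -
  assume "computes P 0 [x] v N"
  then have "wp P [x] (Call 0 [Var 0]) (\<lambda>v' n. v' = v \<and> n \<le> N + 2)"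
    by (auto elim: applies_if_computes)
  then show ?thesis by (auto simp: wp_def runs_def)
qed

section \<open>A program for token moving\<close>

definition enc_bool :: "bool \<Rightarrow> dtree" where
  "enc_bool b = (if b then Node Leaf Leaf else Leaf)"

lemma enc_bool_eq_Leaf [simp]: "enc_bool b = Leaf \<longleftrightarrow> \<not> b" "Leaf = enc_bool b \<longleftrightarrow> \<not> b"
  by (auto simp: enc_bool_def)

lemma enc_bool_simps [simp]: "enc_bool True = Node Leaf Leaf" "enc_bool False = Leaf"
  by (auto simp: enc_bool_def)

fun enc_item :: "nat item \<Rightarrow> dtree" where
  "enc_item None = Leaf"
| "enc_item (Some (b, v)) = Node (enc_bool b) (enc_nat v)"

abbreviation enc_vertices :: "nat list \<Rightarrow> dtree" where
  "enc_vertices \<equiv> enc_list enc_nat"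

abbreviation enc_arcs :: "(nat \<times> nat) list \<Rightarrow> dtree" where
  "enc_arcs \<equiv> enc_list enc_pair"

abbreviation enc_items :: "nat item list \<Rightarrow> dtree" where
  "enc_items \<equiv> enc_list enc_item"

text \<open>In unary, a number \<open>n\<close> is at the same time a list of \<open>n\<close> items \<open>None\<close>.\<close>

primrec unary :: "nat \<Rightarrow> dtree" where
  "unary 0 = Leaf"
| "unary (Suc n) = Node Leaf (unary n)"

abbreviation (input) "SOLVE \<equiv> Suc 0"
abbreviation (input) "SEARCH \<equiv> 2 :: nat"
abbreviation (input) "EQ \<equiv> 3 :: nat"
abbreviation (input) "MEM \<equiv> 4 :: nat"
abbreviation (input) "APP \<equiv> 5 :: nat"
abbreviation (input) "INTER \<equiv> 6 :: nat"
abbreviation (input) "DIFF \<equiv> 7 :: nat"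
abbreviation (input) "LEAVING \<equiv> 8 :: nat"
abbreviation (input) "STEP \<equiv> 9 :: nat"
abbreviation (input) "CLOSE \<equiv> 10 :: nat"
abbreviation (input) "UNARY \<equiv> 11 :: nat"
abbreviation (input) "MINUS \<equiv> 12 :: nat"
abbreviation (input) "TAG \<equiv> 13 :: nat"
abbreviation (input) "BALANCED \<equiv> 14 :: nat"
abbreviation (input) "REACH \<equiv> 15 :: nat"
abbreviation (input) "SPLIT \<equiv> 16 :: nat"
abbreviation (input) "COMBINE \<equiv> 17 :: nat"
abbreviation (input) "MERGE \<equiv> 18 :: nat"

abbreviation "TrueE \<equiv> NodeE LeafE LeafE"

definition uutm_program :: prog where
  "uutm_program =
   [\<comment> \<open>main: an instance\<close>
    Call SOLVE
      [LeftE (Var 0), LeftE (RightE (Var 0)),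
       Call DIFF [LeftE (RightE (RightE (Var 0))), LeftE (RightE (RightE (RightE (Var 0))))],
       Call DIFF [LeftE (RightE (RightE (RightE (Var 0)))), LeftE (RightE (RightE (Var 0)))],
       Call INTER [LeftE (RightE (RightE (Var 0))), LeftE (RightE (RightE (RightE (Var 0))))],
       Call UNARY [RightE (RightE (RightE (RightE (Var 0))))]],
    \<comment> \<open>\<open>SOLVE\<close>: vertices, arcs, sources, targets, obstacles, the parameter in unary\<close>
    If (Var 2)
      (Call SEARCH [Call MINUS [Var 2, Var 5], Var 0, Var 1, Var 2, Var 3, Var 4])
      TrueE,
    \<comment> \<open>\<open>SEARCH\<close>: the tokens left (or \<open>Leaf\<close>), vertices, arcs, sources, targets, obstacles\<close>
    If (Var 0)
      (Call DIFF
        [Call REACH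
          [Call TAG [TrueE, Var 3, Call TAG [LeafE, Var 4, RightE (Var 0)]],
           Var 1, Var 2, Call LEAVING [Var 2, Var 5], Var 5],
         Var 5])
      LeafE,
    \<comment> \<open>\<open>EQ\<close>\<close>
    If (Var 0)
      (If (Var 1)
        (If (Call EQ [LeftE (Var 0), LeftE (Var 1)])
          (Call EQ [RightE (Var 0), RightE (Var 1)])
          LeafE)
        LeafE)
      (If (Var 1) LeafE TrueE),
    \<comment> \<open>\<open>MEM\<close>: element, list\<close>
    If (Var 1)
      (If (Call EQ [LeftE (Var 1), Var 0]) TrueE (Call MEM [Var 0, RightE (Var 1)]))
      LeafE,
    \<comment> \<open>\<open>APP\<close>\<close>
    If (Var 0) (NodeE (LeftE (Var 0)) (Call APP [RightE (Var 0), Var 1])) (Var 1),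
    \<comment> \<open>\<open>INTER\<close>\<close>
    If (Var 0)
      (If (Call MEM [LeftE (Var 0), Var 1])
        (NodeE (LeftE (Var 0)) (Call INTER [RightE (Var 0), Var 1]))
        (Call INTER [RightE (Var 0), Var 1]))
      LeafE,
    \<comment> \<open>\<open>DIFF\<close>\<close>
    If (Var 0)
      (If (Call MEM [LeftE (Var 0), Var 1])
        (Call DIFF [RightE (Var 0), Var 1])
        (NodeE (LeftE (Var 0)) (Call DIFF [RightE (Var 0), Var 1])))
      LeafE,
    \<comment> \<open>\<open>LEAVING\<close>: the arcs that do not start in an obstacle; arguments: arcs, obstacles\<close>
    If (Var 0)
      (If (Call MEM [LeftE (LeftE (Var 0)), Var 1])
        (Call LEAVING [RightE (Var 0), Var 1])
        (NodeE (LeftE (Var 0)) (Call LEAVING [RightE (Var 0), Var 1])))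
      LeafE,
    \<comment> \<open>\<open>STEP\<close>: the successors of some vertices; arguments: arcs, vertices\<close>
    If (Var 0)
      (If (Call MEM [LeftE (LeftE (Var 0)), Var 1])
        (NodeE (RightE (LeftE (Var 0))) (Call STEP [RightE (Var 0), Var 1]))
        (Call STEP [RightE (Var 0), Var 1]))
      LeafE,
    \<comment> \<open>\<open>CLOSE\<close>: list whose length is the number of rounds, initial vertices, all vertices, arcs\<close>
    If (Var 0)
      (Call CLOSE
        [RightE (Var 0),
         Call INTER [Var 2, Call APP [Var 1, Call STEP [Var 3, Var 1]]],
         Var 2, Var 3])
      (Var 1),
    \<comment> \<open>\<open>UNARY\<close>: from binary to unary\<close>
    If (Var 0)
      (If (LeftE (Var 0))
        (NodeE LeafE (Call APP [Call UNARY [RightE (Var 0)], Call UNARY [RightE (Var 0)]]))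
        (Call APP [Call UNARY [RightE (Var 0)], Call UNARY [RightE (Var 0)]]))
      LeafE,
    \<comment> \<open>\<open>MINUS\<close>: a unary number minus the length of a list, below a \<open>Node\<close>, or \<open>Leaf\<close> if negative\<close>
    If (Var 0)
      (If (Var 1) (Call MINUS [RightE (Var 0), RightE (Var 1)]) LeafE)
      (NodeE LeafE (Var 1)),
    \<comment> \<open>\<open>TAG\<close>: tag, vertices to be tagged, list to prepend them to\<close>
    If (Var 1)
      (NodeE (NodeE (Var 0) (LeftE (Var 1))) (Call TAG [Var 0, RightE (Var 1), Var 2]))
      (Var 2),
    \<comment> \<open>\<open>BALANCED\<close>: items, unary counters of the items of either kind\<close>
    If (Var 0)
      (If (LeftE (Var 0))
        (If (LeftE (LeftE (Var 0)))
          (Call BALANCED [RightE (Var 0), NodeE LeafE (Var 1), Var 2])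
          (Call BALANCED [RightE (Var 0), Var 1, NodeE LeafE (Var 2)]))
        (Call BALANCED [RightE (Var 0), Var 1, Var 2]))
      (Call EQ [Var 1, Var 2]),
    \<comment> \<open>\<open>REACH\<close>: items, vertices, arcs, arcs leaving free vertices, obstacles\<close>
    If (Var 0)
      (If (RightE (Var 0))
        (Call CLOSE
          [Var 3, Call SPLIT [Var 0, LeafE, LeafE, Var 1, Var 2, Var 3, Var 4], Var 1, Var 3])
        (If (LeftE (Var 0))
          (Call CLOSE [Var 3, NodeE (RightE (LeftE (Var 0))) LeafE, Var 1, Var 3])
          LeafE))
      LeafE,
    \<comment> \<open>\<open>SPLIT\<close>: items to distribute, the items in the two parts, the rest as for \<open>REACH\<close>\<close>
    If (Var 0)
      (Call INTER
        [Var 3,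
         Call APP
          [Call SPLIT [RightE (Var 0), NodeE (LeftE (Var 0)) (Var 1), Var 2, Var 3, Var 4, Var 5, Var 6],
           Call SPLIT [RightE (Var 0), Var 1, NodeE (LeftE (Var 0)) (Var 2), Var 3, Var 4, Var 5, Var 6]]])
      (Call COMBINE [Var 1, Var 2, Var 3, Var 4, Var 5, Var 6]),
    \<comment> \<open>\<open>COMBINE\<close>: the two parts, the rest as for \<open>REACH\<close>\<close>
    If (Var 0)
      (If (Var 1)
        (Call MERGE
          [Var 0, Call REACH [Var 0, Var 2, Var 3, Var 4, Var 5],
           Call REACH [Var 1, Var 2, Var 3, Var 4, Var 5], Var 2, Var 3, Var 5])
        LeafE)
      LeafE,
    \<comment> \<open>\<open>MERGE\<close>: the first part, the vertices derivable from either part, vertices, arcs, obstacles\<close>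
    Call INTER
      [Var 3,
       If (If (RightE (Var 0)) LeafE (If (LeftE (Var 0)) LeafE TrueE))
        (Call APP [Var 2, Call STEP [Var 4, Var 2]])
        (If (If (Call BALANCED [Var 0, LeafE, LeafE]) (Call DIFF [Var 1, Var 5]) LeafE)
          (Var 2)
          (Call INTER [Var 1, Var 2]))]]"

section \<open>Values and step counts of the list routines\<close>

abbreviation "uutm_computes \<equiv> computes uutm_program"

lemma computesI:
  "f < 19 \<Longrightarrow> wp uutm_program ws (uutm_program ! f) (\<lambda>v' n. v' = v \<and> n \<le> N) \<Longrightarrow> uutm_computes f ws v N"
  by (simp add: computes_def applies_def uutm_program_def)

lemmas nth_uutm_program [simp] =
  arg_cong[OF uutm_program_def, of "\<lambda>P. P ! 0", simplified]
  arg_cong[OF uutm_program_def, of "\<lambda>P. P ! SOLVE", simplified]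
  arg_cong[OF uutm_program_def, of "\<lambda>P. P ! SEARCH", simplified]
  arg_cong[OF uutm_program_def, of "\<lambda>P. P ! EQ", simplified]
  arg_cong[OF uutm_program_def, of "\<lambda>P. P ! MEM", simplified]
  arg_cong[OF uutm_program_def, of "\<lambda>P. P ! APP", simplified]
  arg_cong[OF uutm_program_def, of "\<lambda>P. P ! INTER", simplified]
  arg_cong[OF uutm_program_def, of "\<lambda>P. P ! DIFF", simplified]
  arg_cong[OF uutm_program_def, of "\<lambda>P. P ! LEAVING", simplified]
  arg_cong[OF uutm_program_def, of "\<lambda>P. P ! STEP", simplified]
  arg_cong[OF uutm_program_def, of "\<lambda>P. P ! CLOSE", simplified]
  arg_cong[OF uutm_program_def, of "\<lambda>P. P ! UNARY", simplified]
  arg_cong[OF uutm_program_def, of "\<lambda>P. P ! MINUS", simplified]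
  arg_cong[OF uutm_program_def, of "\<lambda>P. P ! TAG", simplified]
  arg_cong[OF uutm_program_def, of "\<lambda>P. P ! BALANCED", simplified]
  arg_cong[OF uutm_program_def, of "\<lambda>P. P ! REACH", simplified]
  arg_cong[OF uutm_program_def, of "\<lambda>P. P ! SPLIT", simplified]
  arg_cong[OF uutm_program_def, of "\<lambda>P. P ! COMBINE", simplified]
  arg_cong[OF uutm_program_def, of "\<lambda>P. P ! MERGE", simplified]

lemma tree_size_pos [simp]: "0 < tree_size t"
  by (cases t) auto

text \<open>Both trees are descended in lockstep, so the first one alone bounds the cost.\<close>

lemma computes_EQ: "uutm_computes EQ [a, b] (enc_bool (a = b)) (20 * tree_size a)"
proof (induction a arbitrary: b)
  case Leaf
  show ?case by (rule computesI; cases b) auto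
next
  case (Node a1 a2)
  show ?case by (rule computesI; cases b) (auto intro!: Node[THEN applies_if_computes])
qed

text \<open>The list element is passed as first argument of each comparison, so the total is bounded
  by the size of the list, independently of \<open>x\<close>.\<close>

lemma computes_MEM:
  "uutm_computes MEM [enc_nat x, enc_vertices xs] (enc_bool (x \<in> set xs)) (40 * tree_size (enc_vertices xs))"
proof (induction xs)
  case Nil
  show ?case by (rule computesI) auto
next
  case (Cons y xs)
  show ?case
    by (rule computesI)
      (auto intro!: applies_if_computes[OF computes_EQ] applies_if_computes[OF Cons]
        simp: enc_nat_inject enc_bool_def)
qed

lemma computes_APP:
  "uutm_computes APP [enc_list f xs, enc_list f ys] (enc_list f (xs @ ys)) (20 * (length xs + 1))"
proof (induction xs)
  case Nil
  show ?case by (rule computesI) auto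
next
  case (Cons x xs)
  show ?case by (rule computesI) (auto intro!: applies_if_computes[OF Cons])
qed

lemmas applies_MEM = applies_if_computes[OF computes_MEM]

lemma computes_INTER:
  "uutm_computes INTER [enc_vertices xs, enc_vertices ys] (enc_vertices (filter (\<lambda>x. x \<in> set ys) xs))
    (60 * (length xs + 1) * tree_size (enc_vertices ys))"
proof (induction xs)
  case Nil
  have "0 < tree_size (enc_vertices ys)" by simp
  then show ?case by (intro computesI) (auto simp del: tree_size_pos)
next
  case (Cons x xs)
  have "0 < tree_size (enc_vertices ys)" by simp
  then show ?case
    by (intro computesI)
      (auto intro!: applies_MEM applies_if_computes[OF Cons] simp: algebra_simps simp del: tree_size_pos)
qed

lemma computes_DIFF:
  "uutm_computes DIFF [enc_vertices xs, enc_vertices ys] (enc_vertices (filter (\<lambda>x. x \<notin> set ys) xs))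
    (60 * (length xs + 1) * tree_size (enc_vertices ys))"
proof (induction xs)
  case Nil
  have "0 < tree_size (enc_vertices ys)" by simp
  then show ?case by (intro computesI) (auto simp del: tree_size_pos)
next
  case (Cons x xs)
  have "0 < tree_size (enc_vertices ys)" by simp
  then show ?case
    by (intro computesI)
      (auto intro!: applies_MEM applies_if_computes[OF Cons] simp: algebra_simps simp del: tree_size_pos)
qed

lemma enc_pair_sel [simp]: "left (enc_pair e) = enc_nat (fst e)" "right (enc_pair e) = enc_nat (snd e)"
  by (simp_all add: enc_pair_def)

lemma computes_LEAVING:
  "uutm_computes LEAVING [enc_arcs es, enc_vertices ys] (enc_arcs (filter (\<lambda>e. fst e \<notin> set ys) es))
    (60 * (length es + 1) * tree_size (enc_vertices ys))"
proof (induction es)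
  case Nil
  have "0 < tree_size (enc_vertices ys)" by simp
  then show ?case by (intro computesI) (auto simp del: tree_size_pos)
next
  case (Cons e es)
  have "0 < tree_size (enc_vertices ys)" by simp
  then show ?case
    by (intro computesI)
      (auto intro!: applies_MEM applies_if_computes[OF Cons]
        simp: algebra_simps simp del: tree_size_pos)
qed

definition successors :: "(nat \<times> nat) list \<Rightarrow> nat list \<Rightarrow> nat list" where
  "successors es xs = map snd (filter (\<lambda>e. fst e \<in> set xs) es)"

lemma computes_STEP:
  "uutm_computes STEP [enc_arcs es, enc_vertices xs] (enc_vertices (successors es xs))
    (60 * (length es + 1) * tree_size (enc_vertices xs))"
proof (induction es)
  case Nil
  have "0 < tree_size (enc_vertices xs)" by simp
  then show ?case by (intro computesI) (auto simp: successors_def simp del: tree_size_pos)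
next
  case (Cons e es)
  have "0 < tree_size (enc_vertices xs)" by simp
  then show ?case
    by (intro computesI)
      (auto intro!: applies_MEM applies_if_computes[OF Cons]
        simp: successors_def algebra_simps simp del: tree_size_pos)
qed

lemma unary_inject [simp]: "unary m = unary n \<longleftrightarrow> m = n"
proof (induction m arbitrary: n)
  case 0 then show ?case by (cases n) auto
next
  case (Suc m) then show ?case by (cases n) auto
qed

text \<open>The cost is polynomial in the value of \<open>l\<close> and not in its number of digits,
  which is harmless because \<open>l\<close> is the parameter.\<close>

lemma computes_UNARY: "uutm_computes UNARY [enc_nat l] (unary l) (100 * l ^ 2 + 10)"
proof (induction l rule: less_induct)
  case (less l)
  have APP: "uutm_computes APP [unary m, unary n] (unary (m + n)) (20 * (m + 1))" for m n
  proof -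
    have "unary k = enc_list (\<lambda>_. Leaf) (replicate k ())" for k by (induction k) auto
    then show ?thesis
      using computes_APP[of "\<lambda>_. Leaf" "replicate m ()" "replicate n ()"]
      by (simp add: replicate_add)
  qed
  show ?case
  proof (cases "l = 0")
    case True
    show ?thesis unfolding True by (rule computesI) (auto simp: enc_nat.simps[of 0])
  next
    case False
    define q where "q = l div 2"
    have l: "l = 2 * q + (if odd l then 1 else 0)" unfolding q_def by presburger
    have "q < l" using False by (simp add: q_def)
    note IH = applies_if_computes[OF less[OF this]]
    have enc: "enc_nat l = Node (if odd l then Node Leaf Leaf else Leaf) (enc_nat q)"
      using False by (simp add: enc_nat.simps[of l] q_def)
    \<comment> \<open>Two calls on \<open>q\<close> cost \<open>200 * q ^ 2 + 20\<close> and
      appending costs \<open>20 * q + 20\<close>; the remainder of the 80 covers the constant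
      overhead.\<close>
    have "200 * q ^ 2 + 20 * q + 80 \<le> 100 * l ^ 2"
    proof (cases "q = 0")
      case True
      then show ?thesis using l False by (auto split: if_splits)
    next
      case False
      then have "q * 1 \<le> q * q" "1 \<le> q * q" by simp_all
      moreover have "(2 * q) * (2 * q) \<le> l * l" using l by (intro mult_mono) linarith+
      then have "4 * (q * q) \<le> l * l" by simp
      ultimately show ?thesis unfolding power2_eq_square by linarith
    qed
    moreover have "even l \<Longrightarrow> unary (q + q) = unary l"
      and "odd l \<Longrightarrow> Node Leaf (unary (q + q)) = unary l"
      using l by (auto simp flip: unary.simps(2))
    ultimately show ?thesis
      by (intro computesI; cases "odd l") (auto simp: enc intro!: IH applies_if_computes[OF APP])
  qed
qed

lemma computes_MINUS:
  "uutm_computes MINUS [enc_list f xs, unary k]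
    (if length xs \<le> k then Node Leaf (unary (k - length xs)) else Leaf) (20 * (length xs + 1))"
proof (induction xs arbitrary: k)
  case Nil
  show ?case by (rule computesI) auto
next
  case (Cons x xs)
  show ?case by (rule computesI; cases k) (auto intro!: applies_if_computes[OF Cons])
qed

lemma computes_TAG:
  "uutm_computes TAG [enc_bool b, enc_vertices xs, enc_items D]
    (enc_items (map (\<lambda>v. Some (b, v)) xs @ D)) (20 * (length xs + 1))"
proof (induction xs)
  case Nil
  show ?case by (rule computesI) auto
next
  case (Cons x xs)
  show ?case by (rule computesI) (auto intro!: applies_if_computes[OF Cons])
qed

lemma tree_size_unary [simp]: "tree_size (unary n) = 2 * n + 1"
  by (induction n) auto

text \<open>Of the 120 steps per item, 60 pay for the visit and 60 for a possible increment of the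
  first counter, which bounds the final comparison.\<close>

lemma computes_BALANCED:
  "uutm_computes BALANCED [enc_items D, unary m, unary n]
    (enc_bool (int m - int n + excess UNIV (mset D) = 0)) (120 * length D + 60 * (m + 1))"
proof (induction D arbitrary: m n)
  case Nil
  show ?case by (rule computesI) (auto intro!: applies_if_computes[OF computes_EQ])
next
  case (Cons i D)
  note IH = applies_if_computes[OF Cons]
  note IH' = applies_if_computes[OF Cons[of "Suc m" n], simplified]
    applies_if_computes[OF Cons[of m "Suc n"], simplified]
  show ?case
  proof (cases i)
    case None
    then show ?thesis by (intro computesI) (auto intro!: IH)
  next
    case (Some bv)
    then obtain b v where i: "i = Some (b, v)" by (cases bv) auto
    show ?thesis
      by (intro computesI; cases b)
        (auto simp: i weight_def algebra_simps intro!: IH')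
  qed
qed

section \<open>Searching for derivations\<close>

lemma derivable_item: "derivable E Z M v \<Longrightarrow> \<exists>b u. Some (b, u) \<in># M"
  by (induction rule: derivable.induct) auto

text \<open>This leaves the part \<open>{#None#}\<close> available as a mark for spending one unit
  of budget.\<close>

lemma derivable_not_None: "derivable E Z M v \<Longrightarrow> M \<noteq> {#None#}"
  using derivable_item by fastforce

lemma derivable_in:
  assumes "derivable E Z M v" and "E \<subseteq> V \<times> V" and "\<And>b u. Some (b, u) \<in># M \<Longrightarrow> u \<in> V"
  shows "v \<in> V"
  using assms by (induction rule: derivable.induct) auto

definition leaving :: "'a rel \<Rightarrow> 'a set \<Rightarrow> 'a rel" where
  "leaving E Z = {e \<in> E. fst e \<notin> Z}"

text \<open>The last rule other than \<open>free_step\<close>: with \<open>M = {#None#}\<close> it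
  is \<open>weaken\<close> or \<open>paid_step\<close>, otherwise \<open>join\<close> or
  \<open>jump\<close>.\<close>

definition combined :: "'a rel \<Rightarrow> 'a set \<Rightarrow> 'a item multiset \<Rightarrow> 'a item multiset \<Rightarrow> 'a \<Rightarrow> bool" where
  "combined E Z M N v \<longleftrightarrow> M \<noteq> {#} \<and> N \<noteq> {#} \<and>
    (if M = {#None#} then derivable E Z N v \<or> (\<exists>u. derivable E Z N u \<and> (u, v) \<in> E)
     else derivable E Z N v \<and>
      (derivable E Z M v \<or> excess UNIV M = 0 \<and> (\<exists>w. w \<notin> Z \<and> derivable E Z M w)))"

lemma derivable_leaving:
  assumes "(u, v) \<in> (leaving E Z)\<^sup>*" and "derivable E Z M u"
  shows "derivable E Z M v"
  using assms by (induction rule: rtrancl_induct) (auto simp: leaving_def intro: derivable.free_step)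

lemma derivable_singleton_iff:
  "derivable E Z {#i#} v \<longleftrightarrow> (\<exists>b u. i = Some (b, u) \<and> (u, v) \<in> (leaving E Z)\<^sup>*)"
proof
  assume "derivable E Z {#i#} v"
  then show "\<exists>b u. i = Some (b, u) \<and> (u, v) \<in> (leaving E Z)\<^sup>*"
  proof (induction "{#i#}" v rule: derivable.induct)
    case (free_step v u)
    then obtain b w where "i = Some (b, w)" "(w, v) \<in> (leaving E Z)\<^sup>*" by blast
    moreover have "(v, u) \<in> leaving E Z" using free_step.hyps by (simp add: leaving_def)
    ultimately show ?case by (blast intro: rtrancl_into_rtrancl)
  qed (auto simp: union_is_single dest: derivable_nonempty)
qed (auto intro: derivable_leaving derivable.terminal)

text \<open>The recursion behind the search. Free steps keep the items, so the trailing ones are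
  gathered in a closure; the rule before them splits the items into two nonempty, hence smaller,
  parts. Size 2 excludes a bare terminal.\<close>

lemma derivable_iff_combined:
  assumes "size M \<ge> 2"
  shows "derivable E Z M v \<longleftrightarrow>
    (\<exists>u. (u, v) \<in> (leaving E Z)\<^sup>* \<and> (\<exists>A B. A + B = M \<and> combined E Z A B u))"
    (is "_ \<longleftrightarrow> (\<exists>u. _ \<and> ?C M u)")
proof
  assume "derivable E Z M v"
  then show "\<exists>u. (u, v) \<in> (leaving E Z)\<^sup>* \<and> ?C M u"
    using assms
  proof (induction rule: derivable.induct)
    case (free_step M v u)
    then obtain w where "(w, v) \<in> (leaving E Z)\<^sup>*" "?C M w" by blast
    moreover have "(v, u) \<in> leaving E Z" using free_step.hyps by (simp add: leaving_def)
    ultimately show ?case by (blast intro: rtrancl_into_rtrancl)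
  next
    case (paid_step M v u)
    then have "combined E Z {#None#} M u"
      using derivable_nonempty by (auto simp: combined_def)
    then show ?case by (intro exI[of _ u] conjI exI[of _ "{#None#}"] exI[of _ M]) auto
  next
    case (weaken M v)
    then have "combined E Z {#None#} M v"
      using derivable_nonempty by (auto simp: combined_def)
    then show ?case by (intro exI[of _ v] conjI exI[of _ "{#None#}"] exI[of _ M]) auto
  next
    case (join M v N)
    then have "combined E Z M N v"
      using derivable_nonempty[of E Z M] derivable_nonempty[of E Z N] derivable_not_None[of E Z M]
      by (auto simp: combined_def)
    then show ?case by blast
  next
    case (jump M w N v)
    then have "combined E Z M N v"
      using derivable_nonempty[of E Z M] derivable_nonempty[of E Z N] derivable_not_None[of E Z M]
      by (auto simp: combined_def)
    then show ?case by blast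
  qed auto
next
  assume "\<exists>u. (u, v) \<in> (leaving E Z)\<^sup>* \<and> ?C M u"
  then obtain u A B where u: "(u, v) \<in> (leaving E Z)\<^sup>*" "A + B = M" "combined E Z A B u" by blast
  then have "derivable E Z M u"
    by (auto simp: combined_def split: if_splits intro: derivable.intros)
  then show "derivable E Z M v" using u derivable_leaving by fast
qed

text \<open>Each item goes to one of the two parts, which is the branching that \<open>SPLIT\<close>
  performs.\<close>

lemma split_add_mset:
  "(\<exists>A B. A + B = add_mset x M \<and> R A B) \<longleftrightarrow>
    (\<exists>A B. A + B = M \<and> (R (add_mset x A) B \<or> R A (add_mset x B)))"
proof
  assume "\<exists>A B. A + B = add_mset x M \<and> R A B"
  then obtain A B where AB: "A + B = add_mset x M" "R A B" by blast
  then have "x \<in># A \<or> x \<in># B" by (metis union_iff union_single_eq_member)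
  then show "\<exists>A B. A + B = M \<and> (R (add_mset x A) B \<or> R A (add_mset x B))"
  proof
    assume "x \<in># A"
    then obtain A' where "A = add_mset x A'" by (metis multi_member_split)
    then show ?thesis using AB by auto
  next
    assume "x \<in># B"
    then obtain B' where "B = add_mset x B'" by (metis multi_member_split)
    then show ?thesis using AB by auto
  qed
qed (metis union_mset_add_mset_left union_mset_add_mset_right)

section \<open>Tree sizes and reachability by rounds\<close>

lemma length_le_tree_size: "length xs + 1 \<le> tree_size (enc_list f xs)"
  by (induction xs) auto

lemma tree_size_append: "tree_size (enc_list f (xs @ ys)) + 1 = tree_size (enc_list f xs) + tree_size (enc_list f ys)"
  by (induction xs) auto

lemma tree_size_filter: "tree_size (enc_list f (filter R xs)) \<le> tree_size (enc_list f xs)"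
  by (induction xs) auto

lemma tree_size_successors: "tree_size (enc_vertices (successors es xs)) \<le> tree_size (enc_arcs es)"
  by (induction es) (auto simp: successors_def enc_pair_def)

lemma set_successors: "set (successors es xs) = {v. \<exists>u\<in>set xs. (u, v) \<in> set es}"
  by (force simp: successors_def)

text \<open>One round of \<open>CLOSE\<close>. Filtering \<open>vs\<close> keeps vertex sets in a
  canonical order and prevents the lists from growing with the rounds.\<close>

definition spread :: "nat list \<Rightarrow> (nat \<times> nat) list \<Rightarrow> nat list \<Rightarrow> nat list" where
  "spread vs es xs = filter (\<lambda>v. v \<in> set (xs @ successors es xs)) vs"

lemma rounds:
  assumes es: "set es \<subseteq> set vs \<times> set vs" and xs: "filter (\<lambda>v. v \<in> set xs) vs = xs"
  shows "(spread vs es ^^ n) xs = filter (\<lambda>v. \<exists>x\<in>set xs. \<exists>m\<le>n. (x, v) \<in> set es ^^ m) vs"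
proof (induction n)
  case 0
  then show ?case using xs by simp
next
  case (Suc n)
  have "(\<exists>m\<le>Suc n. (x, v) \<in> set es ^^ m) \<longleftrightarrow> (\<exists>m\<le>n. (x, v) \<in> set es ^^ m) \<or>
      (\<exists>m\<le>n. \<exists>u. (x, u) \<in> set es ^^ m \<and> (u, v) \<in> set es)" for x v
  proof
    assume "\<exists>m\<le>Suc n. (x, v) \<in> set es ^^ m"
    then obtain m where m: "m \<le> Suc n" "(x, v) \<in> set es ^^ m" by blast
    show "(\<exists>m\<le>n. (x, v) \<in> set es ^^ m) \<or>
      (\<exists>m\<le>n. \<exists>u. (x, u) \<in> set es ^^ m \<and> (u, v) \<in> set es)"
    proof (cases "m = Suc n")
      case True then show ?thesis using m by auto
    next
      case False then show ?thesis using m by (meson le_SucE)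
    qed
  next
    assume "(\<exists>m\<le>n. (x, v) \<in> set es ^^ m) \<or>
      (\<exists>m\<le>n. \<exists>u. (x, u) \<in> set es ^^ m \<and> (u, v) \<in> set es)"
    then show "\<exists>m\<le>Suc n. (x, v) \<in> set es ^^ m"
    proof
      assume "\<exists>m\<le>n. \<exists>u. (x, u) \<in> set es ^^ m \<and> (u, v) \<in> set es"
      then obtain m u where "m \<le> n" "(x, u) \<in> set es ^^ m" "(u, v) \<in> set es" by blast
      then have "Suc m \<le> Suc n" "(x, v) \<in> set es ^^ Suc m" by auto
      then show ?thesis by blast
    qed (use le_SucI in blast)
  qed
  moreover have "(u, v) \<in> set es \<Longrightarrow> u \<in> set vs" for u v using es by auto
  ultimately have "spread vs es (filter (\<lambda>v. \<exists>x\<in>set xs. \<exists>m\<le>n. (x, v) \<in> set es ^^ m) vs) =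
      filter (\<lambda>v. \<exists>x\<in>set xs. \<exists>m\<le>Suc n. (x, v) \<in> set es ^^ m) vs"
    unfolding spread_def by (intro filter_cong refl) (simp add: set_successors, blast)
  then show ?case by (simp add: Suc.IH)
qed

lemma rounds_rtrancl:
  assumes es: "set es \<subseteq> set vs \<times> set vs" and xs: "filter (\<lambda>v. v \<in> set xs) vs = xs"
  shows "(spread vs es ^^ length es) xs = filter (\<lambda>v. \<exists>x\<in>set xs. (x, v) \<in> (set es)\<^sup>*) vs"
proof -
  \<comment> \<open>A shortest walk needs at most as many steps as there are arcs, so the arc list
    itself can serve as the counter of rounds.\<close>
  have "(x, v) \<in> (set es)\<^sup>* \<longleftrightarrow> (\<exists>m\<le>length es. (x, v) \<in> set es ^^ m)" for x v
  proof
    assume "(x, v) \<in> (set es)\<^sup>*"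
    then obtain m where "m \<le> card (set es)" "(x, v) \<in> set es ^^ m"
      using rtrancl_finite_eq_relpow[of "set es"] by auto
    then show "\<exists>m\<le>length es. (x, v) \<in> set es ^^ m" using card_length order.trans by blast
  qed (auto intro: relpow_imp_rtrancl)
  then show ?thesis unfolding rounds[OF assms] by simp
qed

text \<open>\<open>M\<close> is one common size bound, so that all costs become polynomials in
  \<open>M\<close> times a factor depending on the number of items.\<close>

locale encoded_graph =
  fixes vs :: "nat list" and es :: "(nat \<times> nat) list" and os :: "nat list" and M :: nat
  assumes distinct_vs: "distinct vs" and es_subset: "set es \<subseteq> set vs \<times> set vs"
    and size_vs: "tree_size (enc_vertices vs) \<le> M"
    and size_es: "tree_size (enc_arcs es) \<le> M"
    and size_os: "tree_size (enc_vertices os) \<le> M"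
begin

abbreviation "fs \<equiv> filter (\<lambda>e. fst e \<notin> set os) es"

abbreviation "der \<equiv> derivable (set es) (set os)"

lemma set_fs: "set fs = leaving (set es) (set os)" "set fs \<subseteq> set vs \<times> set vs" "tree_size (enc_arcs fs) \<le> M"
  using es_subset size_es tree_size_filter[of enc_pair "\<lambda>e. fst e \<notin> set os" es]
  by (auto simp: leaving_def)

lemma M_powers: "1 \<le> M" "M \<le> M ^ 2" "1 \<le> M ^ 2" "M ^ 2 \<le> M ^ 3" "1 \<le> M ^ 3"
proof -
  show "1 \<le> M" using size_vs tree_size_pos[of "enc_vertices vs"] by linarith
  then show "M \<le> M ^ 2" "1 \<le> M ^ 2" "M ^ 2 \<le> M ^ 3" "1 \<le> M ^ 3"
    by (auto simp: power2_eq_square power3_eq_cube)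
qed

lemma size_filter: "tree_size (enc_vertices (filter R vs)) \<le> M"
  using tree_size_filter size_vs order.trans by blast

text \<open>The second list may have size \<open>2 * M\<close> because it typically arises by
  appending two lists of size at most \<open>M\<close>.\<close>

lemma computes_INTER_le:
  assumes "tree_size (enc_vertices xs) \<le> M" and "tree_size (enc_vertices ys) \<le> 2 * M"
  shows "uutm_computes INTER [enc_vertices xs, enc_vertices ys] (enc_vertices (filter (\<lambda>x. x \<in> set ys) xs)) (120 * M ^ 2)"
proof (rule computes_mono[OF computes_INTER])
  have "(length xs + 1) * tree_size (enc_vertices ys) \<le> M * (2 * M)"
    using assms length_le_tree_size[of xs enc_nat] by (intro mult_le_mono) auto
  then show "60 * (length xs + 1) * tree_size (enc_vertices ys) \<le> 120 * M ^ 2"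
    by (simp add: power2_eq_square algebra_simps)
qed

lemma computes_DIFF_le:
  assumes "tree_size (enc_vertices xs) \<le> M" and "tree_size (enc_vertices ys) \<le> M"
  shows "uutm_computes DIFF [enc_vertices xs, enc_vertices ys] (enc_vertices (filter (\<lambda>x. x \<notin> set ys) xs)) (60 * M ^ 2)"
proof (rule computes_mono[OF computes_DIFF])
  have "(length xs + 1) * tree_size (enc_vertices ys) \<le> M * M"
    using assms length_le_tree_size[of xs enc_nat] by (intro mult_le_mono) auto
  then show "60 * (length xs + 1) * tree_size (enc_vertices ys) \<le> 60 * M ^ 2"
    by (simp add: power2_eq_square algebra_simps)
qed

lemma computes_STEP_le:
  assumes "tree_size (enc_arcs as) \<le> M" and "tree_size (enc_vertices xs) \<le> M"
  shows "uutm_computes STEP [enc_arcs as, enc_vertices xs] (enc_vertices (successors as xs)) (60 * M ^ 2)"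
proof (rule computes_mono[OF computes_STEP])
  have "(length as + 1) * tree_size (enc_vertices xs) \<le> M * M"
    using assms length_le_tree_size[of as enc_pair] by (intro mult_le_mono) auto
  then show "60 * (length as + 1) * tree_size (enc_vertices xs) \<le> 60 * M ^ 2"
    by (simp add: power2_eq_square algebra_simps)
qed

lemma computes_APP_le:
  assumes "tree_size (enc_vertices xs) \<le> M"
  shows "uutm_computes APP [enc_vertices xs, enc_vertices ys] (enc_vertices (xs @ ys)) (20 * M)"
  using assms length_le_tree_size[of xs enc_nat] by (intro computes_mono[OF computes_APP]) auto

lemma size_append:
  assumes "tree_size (enc_vertices xs) \<le> M" and "tree_size (enc_vertices ys) \<le> M"
  shows "tree_size (enc_vertices (xs @ ys)) \<le> 2 * M"
  using tree_size_append[of enc_nat xs ys] assms by linarith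

lemma size_successors: "tree_size (enc_arcs as) \<le> M \<Longrightarrow> tree_size (enc_vertices (successors as xs)) \<le> M"
  using tree_size_successors order.trans by blast

lemma computes_CLOSE_le:
  assumes "tree_size (enc_vertices xs) \<le> M"
  shows "uutm_computes CLOSE [enc_list f ns, enc_vertices xs, enc_vertices vs, enc_arcs fs]
    (enc_vertices ((spread vs fs ^^ length ns) xs)) (300 * (length ns + 1) * M ^ 2)"
  using assms
proof (induction ns arbitrary: xs)
  case Nil
  then show ?case using M_powers by (intro computesI) auto
next
  case (Cons n ns)
  note size = Cons.prems size_vs set_fs(3) size_successors[OF set_fs(3)] size_append
  have "uutm_computes CLOSE [enc_list f ns, enc_vertices (filter (\<lambda>v. v \<in> set (xs @ successors fs xs)) vs),
      enc_vertices vs, enc_arcs fs]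
    (enc_vertices ((spread vs fs ^^ length (n # ns)) xs)) (300 * (length ns + 1) * M ^ 2)"
    unfolding spread_def[symmetric] length_Cons funpow_Suc_right comp_def
    by (rule Cons.IH) (simp only: spread_def size_filter)
  note IH = applies_if_computes[OF this]
  show ?case
    by (rule computesI)
      (use M_powers in \<open>auto intro!: applies_if_computes[OF computes_STEP_le] applies_if_computes[OF computes_APP_le]
        applies_if_computes[OF computes_INTER_le] IH size simp: algebra_simps simp del: set_append funpow.simps\<close>)
qed

lemma canonical_filter: "filter (\<lambda>v. v \<in> set (filter R vs)) vs = filter R vs"
  by (rule filter_cong) auto

text \<open>Since \<open>vs\<close> has no repetitions, filtering it for a single vertex yields that
  vertex once.\<close>

lemma canonical_singleton: "x \<in> set vs \<Longrightarrow> filter (\<lambda>v. v \<in> set [x]) vs = [x]"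
  using distinct_vs by (induction vs) (auto simp: filter_empty_conv intro: filter_False)

lemma computes_CLOSE_rtrancl:
  assumes xs: "filter (\<lambda>v. v \<in> set xs) vs = xs"
  shows "uutm_computes CLOSE [enc_arcs fs, enc_vertices xs, enc_vertices vs, enc_arcs fs]
    (enc_vertices (filter (\<lambda>v. \<exists>x\<in>set xs. (x, v) \<in> (leaving (set es) (set os))\<^sup>*) vs)) (300 * M ^ 3)"
proof -
  have "tree_size (enc_vertices xs) \<le> M" using size_filter[of "\<lambda>v. v \<in> set xs"] xs by simp
  note computes_CLOSE_le[OF this, of enc_pair fs]
  moreover have "(length fs + 1) * M ^ 2 \<le> M * M ^ 2"
    using length_le_tree_size[of fs enc_pair] set_fs(3) by (intro mult_le_mono) auto
  then have "300 * (length fs + 1) * M ^ 2 \<le> 300 * M ^ 3"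
    by (simp add: power3_eq_cube power2_eq_square algebra_simps)
  ultimately show ?thesis
    unfolding rounds_rtrancl[OF set_fs(2) xs] set_fs(1) by (rule computes_mono)
qed

section \<open>Cost of the recursive search\<close>

definition reached :: "nat item list \<Rightarrow> nat list" where
  "reached D = filter (der (mset D)) vs"

definition valid :: "nat item list \<Rightarrow> bool" where
  "valid D \<longleftrightarrow> (\<forall>b v. Some (b, v) \<in> set D \<longrightarrow> v \<in> set vs)"

lemma der_in_vs: "valid D \<Longrightarrow> der (mset D) v \<Longrightarrow> v \<in> set vs"
  using derivable_in[of "set es" "set os" "mset D" v "set vs"] es_subset by (auto simp: valid_def)

lemma computes_MERGE_le:
  assumes "valid D1" "D1 \<noteq> []" "D2 \<noteq> []" "length D1 \<le> M"
  shows "uutm_computes MERGE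
    [enc_items D1, enc_vertices (reached D1), enc_vertices (reached D2), enc_vertices vs, enc_arcs es, enc_vertices os]
    (enc_vertices (filter (combined (set es) (set os) (mset D1) (mset D2)) vs)) (600 * M ^ 2)"
    (is "uutm_computes _ ?args _ _")
proof -
  obtain i D where D: "D1 = i # D" using assms(2) by (cases D1) auto
  have sel: "right (enc_items D1) = enc_items D" "left (enc_items D1) = enc_item i"
    by (simp_all add: D)
  have is_None: "D1 = [None] \<longleftrightarrow> enc_items D = Leaf \<and> enc_item i = Leaf"
    unfolding D by (cases D; cases i) auto
  have enc_vertices_Leaf: "enc_vertices xs = Leaf \<longleftrightarrow> xs = []" for xs
    by (cases xs) auto
  have size: "tree_size (enc_vertices (reached D)) \<le> M" for D
    unfolding reached_def by (rule size_filter)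
  have size2: "tree_size (enc_vertices (reached D)) \<le> 2 * M"
    "tree_size (enc_vertices (filter R (reached D))) \<le> 2 * M" for R D
    using size[of D] tree_size_filter[of enc_nat R "reached D"] by linarith+
  note sizes = size size2 size_vs size_es size_os size_successors size_append
  have bal: "uutm_computes BALANCED [enc_items D1, Leaf, Leaf] (enc_bool (excess UNIV (mset D1) = 0)) (120 * M + 60)"
    using computes_mono[OF computes_BALANCED[of D1 0 0]] assms(4) by simp
  \<comment> \<open>When a jump is possible, all of \<open>reached D2\<close> qualifies. It contains
    the vertices obtained by joining, so the cases need not be united.\<close>
  let ?Y = "if D1 = [None] then reached D2 @ successors es (reached D2)
    else if excess UNIV (mset D1) = 0 \<and> filter (\<lambda>v. v \<notin> set os) (reached D1) \<noteq> [] then reached D2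
    else filter (\<lambda>v. v \<in> set (reached D2)) (reached D1)"
  have "filter (\<lambda>v. v \<in> set ?Y) vs = filter (combined (set es) (set os) (mset D1) (mset D2)) vs"
  proof (rule filter_cong[OF refl])
    fix v assume v: "v \<in> set vs"
    have "(\<exists>w. w \<notin> set os \<and> der (mset D1) w) \<longleftrightarrow> filter (\<lambda>v. v \<notin> set os) (reached D1) \<noteq> []"
      using der_in_vs[OF assms(1)] by (auto simp: filter_empty_conv reached_def)
    moreover have "(u, v) \<in> set es \<Longrightarrow> u \<in> set vs" for u v using es_subset by auto
    moreover have "mset D1 = {#None#} \<longleftrightarrow> D1 = [None]" by (metis mset_single_iff)
    ultimately show "v \<in> set ?Y \<longleftrightarrow> combined (set es) (set os) (mset D1) (mset D2) v"
      using v assms(2,3) by (auto simp: combined_def reached_def set_successors)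
  qed
  moreover have "uutm_computes MERGE ?args (enc_vertices (filter (\<lambda>v. v \<in> set ?Y) vs)) (600 * M ^ 2)"
  proof (cases "D1 = [None]")
    case True
    then show ?thesis
      by (intro computesI)
        (use M_powers in \<open>auto intro!: applies_if_computes[OF computes_STEP_le] applies_if_computes[OF computes_APP_le]
          applies_if_computes[OF computes_INTER_le] sizes simp del: set_append\<close>)
  next
    case False
    then have "enc_items D \<noteq> Leaf \<or> enc_item i \<noteq> Leaf" using is_None by blast
    then show ?thesis
      using False
      by (intro computesI)
        (use M_powers in \<open>auto intro!: applies_if_computes[OF bal] applies_if_computes[OF computes_DIFF_le]
          applies_if_computes[OF computes_INTER_le] sizes
          simp: sel enc_vertices_Leaf\<close>)
  qed
  ultimately show ?thesis by simp
qed

abbreviation "graph_args \<equiv> [enc_vertices vs, enc_arcs es, enc_arcs fs, enc_vertices os]"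

abbreviation "comb A B \<equiv> combined (set es) (set os) A B"

text \<open>The searches are assumed only when both parts are nonempty. Then each part is shorter
  than the whole list, which makes the recursion terminate.\<close>

lemma computes_COMBINE_le:
  assumes R: "\<And>D. D = D1 \<or> D = D2 \<Longrightarrow> D1 \<noteq> [] \<Longrightarrow> D2 \<noteq> [] \<Longrightarrow>
      uutm_computes REACH (enc_items D # graph_args) (enc_vertices (reached D)) h"
    and "valid D1" "length D1 \<le> M"
  shows "uutm_computes COMBINE (enc_items D1 # enc_items D2 # graph_args)
    (enc_vertices (filter (comb (mset D1) (mset D2)) vs)) (2 * h + 700 * M ^ 2)"
proof (cases "D1 = [] \<or> D2 = []")
  case True
  then have "filter (comb (mset D1) (mset D2)) vs = []" by (auto simp: combined_def)
  then show ?thesis using True M_powers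
    by (intro computesI; cases D1; cases D2) auto
next
  case False
  have ne: "enc_items D = Leaf \<longleftrightarrow> D = []" for D by (cases D) auto
  from False show ?thesis
    by (intro computesI)
      (use M_powers in \<open>auto intro!: applies_if_computes[OF R] applies_if_computes[OF computes_MERGE_le] assms(2,3) simp: ne\<close>)
qed

primrec split_cost :: "nat \<Rightarrow> nat \<Rightarrow> nat" where
  "split_cost h 0 = 2 * h + 800 * M ^ 2"
| "split_cost h (Suc r) = 2 * split_cost h r + 800 * M ^ 2"

text \<open>Adding \<open>800 * M ^ 2\<close> turns the recurrence into pure doubling.\<close>

lemma split_cost_le: "split_cost h r + 800 * M ^ 2 \<le> 2 ^ r * (2 * h + 1600 * M ^ 2)"
  by (induction r) (auto simp: algebra_simps)

lemma computes_SPLIT_le: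
  assumes "\<And>D. length D < m \<Longrightarrow> valid D \<Longrightarrow>
      uutm_computes REACH (enc_items D # graph_args) (enc_vertices (reached D)) h"
    and "length D + length D1 + length D2 = m" "m \<le> M" "valid D" "valid D1" "valid D2"
  shows "uutm_computes SPLIT (enc_items D # enc_items D1 # enc_items D2 # graph_args)
    (enc_vertices (filter (\<lambda>v. \<exists>A B. A + B = mset D \<and> comb (A + mset D1) (B + mset D2) v) vs))
    (split_cost h (length D))"
  using assms(2-)
proof (induction D arbitrary: D1 D2)
  case Nil
  have "uutm_computes COMBINE (enc_items D1 # enc_items D2 # graph_args)
    (enc_vertices (filter (comb (mset D1) (mset D2)) vs)) (2 * h + 700 * M ^ 2)"
  proof (rule computes_COMBINE_le)
    fix D assume D: "D = D1 \<or> D = D2" "D1 \<noteq> []" "D2 \<noteq> []"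
    then have "length D < m" "valid D" using Nil by auto
    then show "uutm_computes REACH (enc_items D # graph_args) (enc_vertices (reached D)) h"
      by (rule assms(1))
  qed (use Nil in auto)
  note COMBINE = applies_if_computes[OF this]
  show ?case
    by (rule computesI) (use M_powers in \<open>auto intro!: COMBINE\<close>)
next
  case (Cons i D)
  let ?R = "\<lambda>D1 D2 v. \<exists>A B. A + B = mset D \<and> comb (A + mset D1) (B + mset D2) v"
  have v: "valid D" "valid (i # D1)" "valid (i # D2)"
    using Cons.prems unfolding valid_def by auto
  note IH1 = applies_if_computes[OF Cons.IH[of "i # D1" D2], simplified enc_list.simps]
  note IH2 = applies_if_computes[OF Cons.IH[of D1 "i # D2"], simplified enc_list.simps]
  have "(\<exists>A B. A + B = mset (i # D) \<and> comb (A + mset D1) (B + mset D2) v) \<longleftrightarrow>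
      ?R (i # D1) D2 v \<or> ?R D1 (i # D2) v" for v
    using split_add_mset[of i "mset D" "\<lambda>A B. comb (A + mset D1) (B + mset D2) v"]
    by (auto 4 4)
  then have eq: "filter (\<lambda>v. \<exists>A B. A + B = mset (i # D) \<and> comb (A + mset D1) (B + mset D2) v) vs =
      filter (\<lambda>v. v \<in> set (filter (?R (i # D1) D2) vs @ filter (?R D1 (i # D2)) vs)) vs"
    by (intro filter_cong) auto
  show ?case
    unfolding eq
    by (rule computesI)
      (use M_powers Cons.prems v in \<open>auto intro!: IH1 IH2 applies_if_computes[OF computes_APP_le]
        applies_if_computes[OF computes_INTER_le] size_vs size_append size_filter simp del: set_append mset.simps\<close>)
qed

text \<open>The induction step of the time bound: \<open>2 ^ r\<close> splits with two searches each
  on lists shorter by one. The factors \<open>2 ^ (r + 1)\<close> multiply up, whence the square in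
  the exponent.\<close>

lemma reach_cost:
  "2 ^ r * (2 * (2000 * M ^ 3 * 2 ^ ((r + 1) ^ 2)) + 1600 * M ^ 2) + 400 * M ^ 3
    \<le> 2000 * M ^ 3 * 2 ^ ((r + 2) ^ 2)"
proof -
  let ?Q = "2000 * M ^ 3" and ?p = "2 ^ ((r + 1) ^ 2) :: nat"
  have p: "1 \<le> ?p" "1 \<le> (2 ^ r :: nat)" by auto
  have "1600 * M ^ 2 \<le> ?Q" using M_powers by linarith
  also have "?Q \<le> ?Q * ?p" by simp
  finally have "2 * (?Q * ?p) + 1600 * M ^ 2 \<le> 3 * (?Q * ?p)" by linarith
  then have "2 ^ r * (2 * (?Q * ?p) + 1600 * M ^ 2) \<le> 2 ^ r * (3 * (?Q * ?p))" by simp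
  moreover have "400 * M ^ 3 * 1 * 1 \<le> ?Q * ?p * 2 ^ r" by (intro mult_le_mono p) auto
  ultimately have "2 ^ r * (2 * (?Q * ?p) + 1600 * M ^ 2) + 400 * M ^ 3 \<le>
      2 ^ r * (3 * (?Q * ?p)) + ?Q * ?p * 2 ^ r" by linarith
  also have "\<dots> = ?Q * (2 ^ (r + 2) * ?p)" by (simp add: algebra_simps)
  also have "\<dots> = ?Q * 2 ^ (r + 2 + (r + 1) ^ 2)" by (simp only: power_add)
  \<comment> \<open>The squares \<open>(r + 2) ^ 2\<close> and \<open>(r + 1) ^ 2\<close> differ by
    \<open>2 * r + 3\<close>, which exceeds \<open>r + 2\<close>.\<close>
  also have "\<dots> \<le> ?Q * 2 ^ ((r + 2) ^ 2)"
    by (intro mult_le_mono order.refl power_increasing) (auto simp: power2_eq_square)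
  finally show ?thesis .
qed

lemma computes_REACH_le:
  assumes "valid D" "length D \<le> M"
  shows "uutm_computes REACH (enc_items D # graph_args) (enc_vertices (reached D))
    (2000 * M ^ 3 * 2 ^ ((length D + 2) ^ 2))"
  using assms
proof (induction "length D" arbitrary: D rule: less_induct)
  case less
  let ?c = "\<lambda>n. 2000 * M ^ 3 * 2 ^ ((n + 2) ^ 2)"
  have base: "400 * M ^ 3 \<le> ?c n" for n
  proof -
    have "400 * M ^ 3 * 1 \<le> ?c n" by (intro mult_le_mono) auto
    then show ?thesis by simp
  qed
  consider "D = []" | i where "D = [i]" | i j D' where "D = i # j # D'"
    by (metis neq_Nil_conv)
  then show ?case
  proof cases
    case 1
    have "reached [] = []" using derivable_nonempty[of "set es" "set os" "{#}"] by (auto simp: reached_def filter_empty_conv)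
    then show ?thesis unfolding 1 using M_powers base[of 0] by (intro computes_mono[OF _ base] computesI) auto
  next
    case (2 i)
    show ?thesis
    proof (cases i)
      case None
      have "reached D = []"
        unfolding 2 None by (auto simp: reached_def filter_empty_conv derivable_singleton_iff)
      then show ?thesis unfolding 2 None using M_powers by (intro computes_mono[OF _ base] computesI) auto
    next
      case (Some bx)
      then obtain b x where i: "i = Some (b, x)" by (cases bx) auto
      have x: "x \<in> set vs" using less.prems unfolding 2 i valid_def by auto
      have "reached D = filter (\<lambda>v. \<exists>x\<in>set [x]. (x, v) \<in> (leaving (set es) (set os))\<^sup>*) vs"
        unfolding 2 i reached_def by (rule filter_cong) (auto simp: derivable_singleton_iff)
      moreover note computes_CLOSE_rtrancl[OF canonical_singleton[OF x]]
      ultimately have "uutm_computes CLOSE [enc_arcs fs, Node (enc_nat x) Leaf, enc_vertices vs, enc_arcs fs]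
          (enc_vertices (reached D)) (300 * M ^ 3)" by simp
      note CLOSE = applies_if_computes[OF this]
      show ?thesis
        by (rule computes_mono[OF computesI base]) (use M_powers in \<open>auto simp: 2 i intro!: CLOSE[unfolded 2 i]\<close>)
    qed
  next
    case (3 i j D')
    define r where "r = length D - 1"
    have len: "length D = Suc r" using 3 by (simp add: r_def)
    let ?F = "\<lambda>v. \<exists>A B. A + B = mset D \<and> comb (A + mset []) (B + mset []) v"
    have "uutm_computes SPLIT (enc_items D # enc_items [] # enc_items [] # graph_args)
      (enc_vertices (filter ?F vs)) (split_cost (?c r) (length D))"
    proof (rule computes_SPLIT_le)
      show "uutm_computes REACH (enc_items D' # graph_args) (enc_vertices (reached D')) (?c r)"
        if "length D' < length D" "valid D'" for D'
      proof (rule computes_mono[OF less.hyps[OF that]])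
        have "(length D' + 2) ^ 2 \<le> (r + 2) ^ 2" using that(1) len by (intro power_mono) auto
        then show "?c (length D') \<le> ?c r" by (intro mult_le_mono power_increasing) (use M_powers in auto)
      qed (use that less.prems M_powers in auto)
    qed (use less.prems M_powers in \<open>auto simp: valid_def\<close>)
    note SPLIT = applies_if_computes[OF this]
    have "reached D = filter (\<lambda>v. \<exists>x\<in>set (filter ?F vs). (x, v) \<in> (leaving (set es) (set os))\<^sup>*) vs"
      unfolding reached_def
    proof (rule filter_cong[OF refl])
      fix v
      have size: "2 \<le> size (mset D)" using 3 by simp
      \<comment> \<open>The closure may start from listed vertices only, since every combined vertex
        is derivable and thus belongs to \<open>vs\<close>.\<close>
      have "?F u \<Longrightarrow> u \<in> set vs" for u
        using der_in_vs[OF less.prems(1)] derivable_iff_combined[OF size, of "set es" "set os" u] by auto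
      then show "der (mset D) v \<longleftrightarrow> (\<exists>x\<in>set (filter ?F vs). (x, v) \<in> (leaving (set es) (set os))\<^sup>*)"
        unfolding derivable_iff_combined[OF size] by auto
    qed
    then have "uutm_computes CLOSE [enc_arcs fs, enc_vertices (filter ?F vs), enc_vertices vs, enc_arcs fs]
        (enc_vertices (reached D)) (300 * M ^ 3)"
      using computes_CLOSE_rtrancl[OF canonical_filter[of ?F]] by simp
    note CLOSE = applies_if_computes[OF this]
    have ne: "enc_items D \<noteq> Leaf" "right (enc_items D) \<noteq> Leaf" by (simp_all add: 3)
    have "split_cost (?c r) (length D) + 400 * M ^ 3 \<le> ?c (length D)"
      using split_cost_le[of "?c r" "length D"] reach_cost[of "length D"] by (simp add: len)
    then show ?thesis
      by (intro computesI) (use M_powers ne in \<open>auto intro!: SPLIT[simplified] CLOSE[simplified]\<close>)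
  qed
qed

lemma computes_SEARCH_le:
  fixes k as bs
  defines "D \<equiv> map (\<lambda>v. Some (True, v)) as @ map (\<lambda>v. Some (False, v)) bs @ replicate k None"
  assumes "set as \<subseteq> set vs" "set bs \<subseteq> set vs" "length as + length bs + k \<le> M"
  shows "uutm_computes SEARCH
    [Node Leaf (unary k), enc_vertices vs, enc_arcs es, enc_vertices as, enc_vertices bs, enc_vertices os]
    (enc_vertices (filter (\<lambda>v. v \<notin> set os) (reached D)))
    (2000 * M ^ 3 * 2 ^ ((length D + 2) ^ 2) + 300 * M ^ 3)"
proof -
  have unary: "unary k = enc_items (replicate k None)" by (induction k) auto
  have len: "length D = length as + length bs + k" by (simp add: D_def)
  have TAG: "uutm_computes TAG [enc_bool b, enc_vertices xs, enc_items E]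
      (enc_items (map (\<lambda>v. Some (b, v)) xs @ E)) (20 * M + 20)" if "length xs \<le> M" for b xs E
    using that by (intro computes_mono[OF computes_TAG]) auto
  note TAG1 = TAG[of as True "map (\<lambda>v. Some (False, v)) bs @ replicate k None", folded D_def, simplified]
  note TAG2 = TAG[of bs False "replicate k None", simplified]
  have LEAVING: "uutm_computes LEAVING [enc_arcs es, enc_vertices os] (enc_arcs fs) (60 * M ^ 2)"
  proof (rule computes_mono[OF computes_LEAVING])
    have "(length es + 1) * tree_size (enc_vertices os) \<le> M * M"
      using size_es size_os length_le_tree_size[of es enc_pair] by (intro mult_le_mono) auto
    then show "60 * (length es + 1) * tree_size (enc_vertices os) \<le> 60 * M ^ 2"
      by (simp add: power2_eq_square algebra_simps)
  qed
  have "valid D" using assms(2,3) by (auto simp: valid_def D_def)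
  then have REACH: "uutm_computes REACH (enc_items D # graph_args) (enc_vertices (reached D))
      (2000 * M ^ 3 * 2 ^ ((length D + 2) ^ 2))"
    using assms(4) len by (intro computes_REACH_le) simp_all
  have DIFF: "uutm_computes DIFF [enc_vertices (reached D), enc_vertices os]
      (enc_vertices (filter (\<lambda>v. v \<notin> set os) (reached D))) (60 * M ^ 2)"
    unfolding reached_def by (intro computes_DIFF_le size_filter size_os)
  show ?thesis
    by (rule computesI)
      (use M_powers assms(4) in \<open>auto intro!: applies_if_computes[OF TAG1] applies_if_computes[OF TAG2]
        applies_if_computes[OF LEAVING] applies_if_computes[OF REACH] applies_if_computes[OF DIFF]
        simp: unary\<close>)
qed

end

section \<open>A computable double exponential\<close>

text \<open>Function 1 prepends \<open>2 ^ n\<close> leaves to its second argument if the first has a spine of length \<open>n\<close>.\<close>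

definition bound_program :: prog where
  "bound_program =
   [Call (Suc 0)
      [Call (Suc 0) [Var 0, (NodeE LeafE ^^ 6) LeafE], NodeE (NodeE LeafE LeafE) LeafE],
    If (Var 0)
      (Call (Suc 0) [RightE (Var 0), Call (Suc 0) [RightE (Var 0), Var 1]])
      (NodeE LeafE (Var 1))]"

lemmas nth_bound_program [simp] =
  arg_cong[OF bound_program_def, of "\<lambda>P. P ! 0", simplified]
  arg_cong[OF bound_program_def, of "\<lambda>P. P ! Suc 0", simplified]

primrec spine :: "dtree \<Rightarrow> nat" where
  "spine Leaf = 0"
| "spine (Node x y) = Suc (spine y)"

lemma bound_computesI:
  "f < 2 \<Longrightarrow> wp bound_program ws (bound_program ! f) (\<lambda>v' n. v' = v \<and> n \<le> N) \<Longrightarrow> computes bound_program f ws v N"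
  by (simp add: computes_def applies_def bound_program_def)

lemma wp_leaves [simp]:
  "wp P vs ((NodeE LeafE ^^ n) LeafE) Q \<longleftrightarrow> Q ((Node Leaf ^^ n) Leaf) (2 * n + 1)"
  by (induction n arbitrary: Q) auto

lemma computes_double: "\<exists>N. computes bound_program (Suc 0) [t, acc] ((Node Leaf ^^ (2 ^ spine t)) acc) N"
proof (induction t arbitrary: acc)
  case Leaf
  show ?case by (intro exI[of _ 10] bound_computesI) auto
next
  case (Node x y)
  obtain N where N: "computes bound_program (Suc 0) [y, acc] ((Node Leaf ^^ (2 ^ spine y)) acc) N"
    using Node by blast
  obtain N' where N': "computes bound_program (Suc 0) [y, (Node Leaf ^^ (2 ^ spine y)) acc]
      ((Node Leaf ^^ (2 ^ spine y)) ((Node Leaf ^^ (2 ^ spine y)) acc)) N'"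
    using Node by blast
  have eq: "(Node Leaf ^^ (2 ^ spine (Node x y))) acc =
      (Node Leaf ^^ (2 ^ spine y)) ((Node Leaf ^^ (2 ^ spine y)) acc)"
    by (simp add: mult_2 funpow_add)
  show ?case unfolding eq
    by (intro exI[of _ "N + N' + 20"] bound_computesI)
      (auto intro!: applies_if_computes[OF N] applies_if_computes[OF N'])
qed

text \<open>In binary, least digit first, a power of two is a run of zeros followed by a one.
  Prepending \<open>2 ^ n\<close> leaves to the code of 1 therefore yields a double
  exponential.\<close>

lemma enc_nat_power: "enc_nat (2 ^ n) = (Node Leaf ^^ n) (Node (Node Leaf Leaf) Leaf)"
proof (induction n)
  case 0
  show ?case by (simp add: enc_nat.simps[of "Suc 0"] enc_nat.simps[of 0])
next
  case (Suc n)
  then show ?case by (simp add: enc_nat.simps[of "2 * 2 ^ n"])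
qed

text \<open>The spine of \<open>enc_nat k\<close> is the number of binary digits of
  \<open>k\<close>, so \<open>2 ^ spine (enc_nat k)\<close> exceeds \<open>k\<close>. The 6 absorbs
  the constants of the running time.\<close>

definition bound :: "nat \<Rightarrow> nat" where
  "bound k = 2 ^ 2 ^ (6 + 2 ^ spine (enc_nat k))"

lemma computable_bound: "computable bound"
proof -
  have spine: "spine ((Node Leaf ^^ n) t) = n + spine t" for n t
    by (induction n) auto
  have "\<exists>n. runs bound_program (enc_nat k) (enc_nat (bound k)) n" for k
  proof -
    let ?s = "(Node Leaf ^^ 6) Leaf"
    let ?t = "(Node Leaf ^^ (2 ^ spine (enc_nat k))) ?s"
    obtain N where N: "computes bound_program (Suc 0) [enc_nat k, ?s] ?t N"
      using computes_double by blast
    have "spine ?t = 6 + 2 ^ spine (enc_nat k)" by (simp add: spine)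
    then obtain N' where N': "computes bound_program (Suc 0) [?t, Node (Node Leaf Leaf) Leaf] (enc_nat (bound k)) N'"
      using computes_double[of ?t "Node (Node Leaf Leaf) Leaf"] by (auto simp: bound_def enc_nat_power)
    have "computes bound_program 0 [enc_nat k] (enc_nat (bound k)) (N + N' + 50)"
      by (rule bound_computesI)
        (use N N' in \<open>auto intro!: applies_if_computes[OF N] applies_if_computes[OF N']\<close>)
    then show ?thesis using runs_if_computes by blast
  qed
  then show ?thesis unfolding computable_def by blast
qed

lemma less_spine: "k < 2 ^ spine (enc_nat k)"
proof (induction k rule: less_induct)
  case (less k)
  show ?case
  proof (cases "k = 0")
    case False
    then have "k div 2 < 2 ^ spine (enc_nat (k div 2))" using less by simp
    then show ?thesis using False by (subst enc_nat.simps) simp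
  qed simp
qed

lemma le_bound: "4000 * (2 * l + 2) ^ 3 * 2 ^ ((2 * l + 2) ^ 2) \<le> bound l"
proof -
  have lin: "n + 1 \<le> 2 ^ n" for n :: nat using less_exp[of n] by linarith
  have sq: "l * l \<le> 2 * 2 ^ l"
  proof (induction l)
    case (Suc l)
    then show ?case using lin[of l] by simp
  qed simp
  have "2 * l + 2 \<le> 2 ^ (2 * l + 2)" using lin[of "2 * l + 2"] by linarith
  then have "(2 * l + 2) ^ 3 \<le> (2 ^ (2 * l + 2)) ^ 3" by (rule power_mono) simp
  \<comment> \<open>The factor 4000 is rounded up to \<open>2 ^ 12\<close>.\<close>
  then have "4000 * (2 * l + 2) ^ 3 * 2 ^ ((2 * l + 2) ^ 2) \<le> 2 ^ 12 * (2 ^ (2 * l + 2)) ^ 3 * 2 ^ ((2 * l + 2) ^ 2)"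
    by (intro mult_le_mono) auto
  also have "\<dots> = 2 ^ (12 + (2 * l + 2) * 3 + (2 * l + 2) ^ 2)"
    by (simp only: power_add power_mult)
  also have "\<dots> \<le> 2 ^ 2 ^ (6 + 2 ^ spine (enc_nat l))"
  proof (rule power_increasing)
    have "12 + (2 * l + 2) * 3 + (2 * l + 2) ^ 2 = 22 + 14 * l + 4 * (l * l)"
      by (simp add: power2_eq_square algebra_simps)
    \<comment> \<open>By \<open>l + 1 \<le> 2 ^ l\<close> and \<open>l * l \<le> 2 * 2 ^ l\<close>
      the sum is at most \<open>30 * 2 ^ l\<close>.\<close>
    also have "\<dots> \<le> 2 ^ 6 * 2 ^ l" using lin[of l] sq by simp
    also have "\<dots> = 2 ^ (6 + l)" by (simp only: power_add)
    also have "\<dots> \<le> 2 ^ (6 + 2 ^ spine (enc_nat l))"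
      using less_spine[of l] by (intro power_increasing) auto
    finally show "12 + (2 * l + 2) * 3 + (2 * l + 2) ^ 2 \<le> 2 ^ (6 + 2 ^ spine (enc_nat l))" .
  qed simp
  finally show ?thesis unfolding bound_def .
qed

section \<open>Fixed-parameter tractability\<close>

lemma excess_eq_cards:
  assumes "distinct as" "distinct bs"
  shows "excess K (mset (map (\<lambda>v. Some (True, v)) as @ map (\<lambda>v. Some (False, v)) bs)) =
    int (card (K \<inter> set as)) - int (card (K \<inter> set bs))"
proof -
  have "excess K (mset (map (\<lambda>v. Some (b, v)) xs)) = (if b then 1 else -1) * int (card (K \<inter> set xs))"
    if "distinct xs" for b xs
    using that by (induction xs) (auto simp: weight_def)
  then show ?thesis using assms by (simp add: excess_def)
qed

text \<open>Both sides amount to the existence of a balancing set of at most \<open>k\<close>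
  obstacles, where \<open>k\<close> is what remains of \<open>l\<close> after one move per vertex of
  \<open>S - T\<close>. Equal cardinalities of \<open>S\<close> and \<open>T\<close> make the total
  excess 0.\<close>

theorem uutm_yes_iff_derivable:
  fixes as bs k
  defines "D \<equiv> map (\<lambda>v. Some (True, v)) as @ map (\<lambda>v. Some (False, v)) bs @ replicate k None"
  assumes inst: "uutm_instance (G, S, T, l)"
    and as: "distinct as" "set as = S - T" "as \<noteq> []" and bs: "distinct bs" "set bs = T - S"
    and l: "l = length as + k"
  shows "uutm_yes (G, S, T, l) \<longleftrightarrow>
    (\<exists>v\<in>pverts G - S \<inter> T. derivable (parcs G) (S \<inter> T) (mset D) v)"
proof -
  have G: "pair_graph G" and ST: "S \<subseteq> pverts G" "T \<subseteq> pverts G" "card S = card T"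
    using inst by (auto simp: uutm_instance_def)
  interpret pair_graph G by (fact G)
  have fin: "finite S" "finite T" using ST pair_finite_verts finite_subset by blast+
  have sym: "sym (parcs G)" using pair_sym_arcs by (auto simp: symmetric_def)
  have E: "parcs G \<subseteq> pverts G \<times> pverts G" by (auto dest: in_arcsD1 in_arcsD2)
  let ?M = "mset (map (\<lambda>v. Some (True, v)) as @ map (\<lambda>v. Some (False, v)) bs)"
  have D: "mset D = replicate_mset k None + ?M" by (simp add: D_def)
  note excess = excess_eq_cards[OF as(1) bs(1), unfolded as(2) bs(2)]
  have card: "card (S - T) = length as" using as distinct_card by metis
  have "card (UNIV \<inter> (S - T)) = card (UNIV \<inter> (T - S))"
    using card_Int_Diff_iff[OF fin, of UNIV] ST(3) by simp
  then have "excess UNIV ?M = 0" unfolding excess by simp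
  then have "(\<exists>v\<in>pverts G - S \<inter> T. derivable (parcs G) (S \<inter> T) (replicate_mset k None + ?M) v) \<longleftrightarrow>
    (\<exists>P\<subseteq>S \<inter> T. card P \<le> k \<and> (\<forall>K. closed_in (parcs G) (pverts G - (S \<inter> T - P)) K \<longrightarrow> excess K ?M = 0))"
    using as bs ST by (intro derivable_iff_balanced pair_finite_verts E sym) auto
  also have "\<dots> \<longleftrightarrow> uutm_yes (G, S, T, l)"
    using transforming_sequence_iff_balanced[OF G ST(1,2), of l]
    unfolding uutm_yes_def excess by (simp add: card l)
  finally show ?thesis unfolding D by simp
qed

text \<open>Without terminals nothing is derivable, so this case is settled apart.\<close>

lemma uutm_yes_trivial:
  assumes "uutm_instance (G, S, T, l)" and "S - T = {}"
  shows "uutm_yes (G, S, T, l)"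
proof -
  have "pair_graph G" "T \<subseteq> pverts G" "card S = card T" "S \<subseteq> T"
    using assms by (auto simp: uutm_instance_def)
  moreover from this have "finite T" using finite_subset pair_fin_digraph.pair_finite_verts
    by (metis pair_graph_def pair_digraph_def)
  ultimately have "S = T" by (simp add: card_subset_eq)
  then show ?thesis by (auto simp: uutm_yes_def intro: exI[of _ "[]"])
qed

lemma uutm_yes_card:
  assumes "uutm_instance (G, S, T, l)" and "uutm_yes (G, S, T, l)"
  shows "card (S - T) \<le> l"
  using assms transforming_sequence_iff_balanced[of G S T l]
  by (auto simp: uutm_instance_def uutm_yes_def)

lemma computes_main:
  assumes inst: "uutm_instance (G, S, T, l)" and enc: "uutm_encoding (G, S, T, l) x"
  shows "\<exists>v. uutm_computes 0 [x] v (3000 * (tree_size x * (2 * l + 2)) ^ 3 * 2 ^ ((2 * l + 2) ^ 2)) \<and>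
    (v \<noteq> Leaf \<longleftrightarrow> uutm_yes (G, S, T, l))"
proof -
  obtain vs es ss ts where vs: "distinct vs" "set vs = pverts G" and es: "distinct es" "set es = parcs G"
    and ss: "distinct ss" "set ss = S" and ts: "distinct ts" "set ts = T"
    and x: "x = Node (enc_vertices vs) (Node (enc_arcs es)
      (Node (enc_vertices ss) (Node (enc_vertices ts) (enc_nat l))))"
    using enc by (auto simp: uutm_encoding_def)
  have G: "pair_graph G" and ST: "S \<subseteq> pverts G" "T \<subseteq> pverts G" "card S = card T"
    using inst by (auto simp: uutm_instance_def)
  interpret pair_graph G by (fact G)
  \<comment> \<open>This product bounds the sizes of the input lists and also the number of items,
    which is at most \<open>2 * l\<close>.\<close>
  define M where "M = tree_size x * (2 * l + 2)"
  define as where "as = filter (\<lambda>v. v \<notin> set ts) ss"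
  define bs where "bs = filter (\<lambda>v. v \<notin> set ss) ts"
  define os where "os = filter (\<lambda>v. v \<in> set ts) ss"
  have as: "distinct as" "set as = S - T" and bs: "distinct bs" "set bs = T - S"
    and os: "set os = S \<inter> T"
    using ss ts by (auto simp: as_def bs_def os_def)
  have xM: "tree_size x \<le> M" "2 * l + 2 \<le> M"
    using mult_le_mono[of "tree_size x" "tree_size x" 1 "2 * l + 2"]
      mult_le_mono[of 1 "tree_size x" "2 * l + 2" "2 * l + 2"] tree_size_pos[of x]
    unfolding M_def by auto
  have size: "tree_size (enc_vertices vs) \<le> M" "tree_size (enc_arcs es) \<le> M"
    "tree_size (enc_vertices ss) \<le> M" "tree_size (enc_vertices ts) \<le> M"
    "tree_size (enc_vertices os) \<le> M" "tree_size (enc_vertices as) \<le> M"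
    using xM tree_size_filter[of enc_nat "\<lambda>v. v \<in> set ts" ss]
      tree_size_filter[of enc_nat "\<lambda>v. v \<notin> set ts" ss]
    by (auto simp: x os_def as_def)
  interpret encoded_graph vs es os M
    using vs es size by unfold_locales (auto dest: in_arcsD1 in_arcsD2)
  have DIFF1: "uutm_computes DIFF [enc_vertices ss, enc_vertices ts] (enc_vertices as) (60 * M ^ 2)"
    and DIFF2: "uutm_computes DIFF [enc_vertices ts, enc_vertices ss] (enc_vertices bs) (60 * M ^ 2)"
    and INTER: "uutm_computes INTER [enc_vertices ss, enc_vertices ts] (enc_vertices os) (120 * M ^ 2)"
    unfolding as_def bs_def os_def using size by (auto intro!: computes_DIFF_le computes_INTER_le)
  have "l ^ 2 \<le> M ^ 2" using xM by (intro power_mono) auto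
  then have UNARY: "uutm_computes UNARY [enc_nat l] (unary l) (100 * M ^ 2 + 10)"
    by (intro computes_mono[OF computes_UNARY]) auto
  let ?N = "2000 * M ^ 3 * 2 ^ ((2 * l + 2) ^ 2) + 300 * M ^ 3 + 30 * M + 50"
  have SOLVE: "\<exists>v. uutm_computes SOLVE
      [enc_vertices vs, enc_arcs es, enc_vertices as, enc_vertices bs, enc_vertices os, unary l] v ?N \<and>
    (v \<noteq> Leaf \<longleftrightarrow> uutm_yes (G, S, T, l))"
  proof (cases "as = []")
    case True
    then have "uutm_yes (G, S, T, l)" using inst as uutm_yes_trivial by simp
    moreover have "uutm_computes SOLVE
      [enc_vertices vs, enc_arcs es, enc_vertices as, enc_vertices bs, enc_vertices os, unary l]
      (Node Leaf Leaf) ?N"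
      by (rule computesI) (auto simp: True)
    ultimately show ?thesis by blast
  next
    case False
    then have ne: "enc_vertices as \<noteq> Leaf" by (cases as) auto
    have card: "card (S - T) = length as" using as distinct_card by metis
    have "length as \<le> M" using size length_le_tree_size[of as enc_nat] by linarith
    then have MINUS: "uutm_computes MINUS [enc_vertices as, unary l]
      (if length as \<le> l then Node Leaf (unary (l - length as)) else Leaf) (20 * M + 20)"
      by (intro computes_mono[OF computes_MINUS]) auto
    show ?thesis
    proof (cases "length as \<le> l")
      case False
      then have "\<not> uutm_yes (G, S, T, l)" using uutm_yes_card[OF inst] card by auto
      moreover have "uutm_computes SOLVE
        [enc_vertices vs, enc_arcs es, enc_vertices as, enc_vertices bs, enc_vertices os, unary l] Leaf ?N"
      proof -
        have "uutm_computes SEARCH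
          [Leaf, enc_vertices vs, enc_arcs es, enc_vertices as, enc_vertices bs, enc_vertices os] Leaf 10"
          by (rule computesI) auto
        note SEARCH = applies_if_computes[OF this]
        show ?thesis
          by (rule computesI) (use False ne M_powers in \<open>auto intro!: applies_if_computes[OF MINUS] SEARCH\<close>)
      qed
      ultimately show ?thesis by blast
    next
      case True
      define k where "k = l - length as"
      define D where "D = map (\<lambda>v. Some (True, v)) as @ map (\<lambda>v. Some (False, v)) bs @ replicate k None"
      have l: "l = length as + k" using True by (simp add: k_def)
      have "card (UNIV \<inter> (S - T)) = card (UNIV \<inter> (T - S))"
        using card_Int_Diff_iff[of S T UNIV] ST ss(2) ts(2) by auto
      then have len: "length bs = length as" using card bs distinct_card by fastforce
      then have lenD: "length as + length bs + k \<le> 2 * l" "length D \<le> 2 * l"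
        using l by (auto simp: D_def)
      have "uutm_computes SEARCH
        [Node Leaf (unary k), enc_vertices vs, enc_arcs es, enc_vertices as, enc_vertices bs, enc_vertices os]
        (enc_vertices (filter (\<lambda>v. v \<notin> set os) (reached D)))
        (2000 * M ^ 3 * 2 ^ ((length D + 2) ^ 2) + 300 * M ^ 3)"
        unfolding D_def using as bs ST vs lenD xM by (intro computes_SEARCH_le) auto
      moreover have "(2::nat) ^ ((length D + 2) ^ 2) \<le> 2 ^ ((2 * l + 2) ^ 2)"
        using lenD by (intro power_increasing power_mono) auto
      ultimately have "uutm_computes SEARCH
        [Node Leaf (unary k), enc_vertices vs, enc_arcs es, enc_vertices as, enc_vertices bs, enc_vertices os]
        (enc_vertices (filter (\<lambda>v. v \<notin> set os) (reached D)))
        (2000 * M ^ 3 * 2 ^ ((2 * l + 2) ^ 2) + 300 * M ^ 3)"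
        by (elim computes_mono) (intro add_mono mult_le_mono order.refl)
      note SEARCH = applies_if_computes[OF this]
      have "uutm_computes SOLVE
        [enc_vertices vs, enc_arcs es, enc_vertices as, enc_vertices bs, enc_vertices os, unary l]
        (enc_vertices (filter (\<lambda>v. v \<notin> set os) (reached D))) ?N"
        by (rule computesI)
          (use True ne M_powers in \<open>auto intro!: applies_if_computes[OF MINUS] SEARCH[unfolded k_def]\<close>)
      moreover have "enc_vertices xs \<noteq> Leaf \<longleftrightarrow> xs \<noteq> []" for xs by (cases xs) auto
      moreover have "filter (\<lambda>v. v \<notin> set os) (reached D) \<noteq> [] \<longleftrightarrow> uutm_yes (G, S, T, l)"
        unfolding uutm_yes_iff_derivable[OF inst as False bs l, folded D_def]
        by (auto simp: reached_def filter_empty_conv vs es os)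
      ultimately show ?thesis by blast
    qed
  qed
  then obtain v where v: "uutm_computes SOLVE
      [enc_vertices vs, enc_arcs es, enc_vertices as, enc_vertices bs, enc_vertices os, unary l] v ?N"
    "v \<noteq> Leaf \<longleftrightarrow> uutm_yes (G, S, T, l)" by blast
  have "M ^ 3 * 1 \<le> M ^ 3 * 2 ^ ((2 * l + 2) ^ 2)" by (intro mult_le_mono) auto
  moreover have "2000 * M ^ 3 * 2 ^ ((2 * l + 2) ^ 2) = 2000 * (M ^ 3 * 2 ^ ((2 * l + 2) ^ 2))"
    "3000 * M ^ 3 * 2 ^ ((2 * l + 2) ^ 2) = 3000 * (M ^ 3 * 2 ^ ((2 * l + 2) ^ 2))" by simp_all
  \<comment> \<open>The 340 adds up two differences (60 each), one intersection (120) and the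
    conversion to unary (100); 150 covers the constants.\<close>
  ultimately have "?N + 340 * M ^ 2 + 150 \<le> 3000 * M ^ 3 * 2 ^ ((2 * l + 2) ^ 2)"
    using M_powers by linarith
  then have "uutm_computes 0 [x] v (3000 * M ^ 3 * 2 ^ ((2 * l + 2) ^ 2))"
    by (intro computesI)
      (auto simp: x intro!: applies_if_computes[OF DIFF1] applies_if_computes[OF DIFF2]
        applies_if_computes[OF INTER] applies_if_computes[OF UNARY] applies_if_computes[OF v(1)])
  then show ?thesis using v(2) unfolding M_def by blast
qed

theorem theorem1:
  shows "fixed_parameter_tractable uutm_instance uutm_encoding uutm_parameter uutm_yes"
  unfolding fixed_parameter_tractable_def
proof (rule exI[of _ uutm_program], rule exI[of _ bound], rule exI[of _ 3], intro conjI allI impI)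
  show "computable bound" by (rule computable_bound)
  fix i :: uutm and x assume ix: "uutm_instance i \<and> uutm_encoding i x"
  obtain G S T l where i: "i = (G, S, T, l)" by (cases i)
  let ?c = "\<lambda>k. k * (tree_size x * (2 * l + 2)) ^ 3 * 2 ^ ((2 * l + 2) ^ 2)"
  obtain v where v: "uutm_computes 0 [x] v (?c 3000)" "v \<noteq> Leaf \<longleftrightarrow> uutm_yes i"
    using computes_main ix unfolding i by blast
  then obtain n where n: "n \<le> ?c 3000 + 2" "runs uutm_program x v n"
    using runs_if_computes by blast
  have "1 \<le> (tree_size x * (2 * l + 2)) ^ 3"
    by (rule one_le_power) (simp add: Suc_le_eq)
  \<comment> \<open>Raising the factor from 3000 to 4000 absorbs the 2 steps of the initial
    call.\<close>
  then have "1000 * 1 * 1 \<le> ?c 1000" by (intro mult_le_mono) auto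
  then have "?c 3000 + 2 \<le> ?c 4000" by simp
  also have "\<dots> = 4000 * (2 * l + 2) ^ 3 * 2 ^ ((2 * l + 2) ^ 2) * tree_size x ^ 3"
    by (simp only: power_mult_distrib ac_simps)
  also have "\<dots> \<le> bound l * tree_size x ^ 3" by (intro mult_le_mono le_bound order.refl)
  finally have "n \<le> bound (uutm_parameter i) * tree_size x ^ 3"
    using n(1) by (simp add: i uutm_parameter_def)
  then show "\<exists>v n. runs uutm_program x v n \<and> n \<le> bound (uutm_parameter i) * tree_size x ^ 3 \<and>
      (v \<noteq> Leaf \<longleftrightarrow> uutm_yes i)"
    using n(2) v(2) by blast
qed

end
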